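(* Let $B, C, D$ be unital C*-algebras, let $\delta : B\to D$ and $\gamma : C\to D$ be unital $\ast$-homomorphisms such that either $\gamma$ or $\delta$ is surjective, and let $A := \{(b,c)\in B\oplus C : \delta(b) = \gamma(c)\}$ be the pullback. Then $$csr(A) \leq \max\{csr(B),csr(C),\mathrm{inj}_0(D),\mathrm{surj}_1(D)\}.$$
   Context: For a unital C*-algebra $A$ and $n\ge 1$, $Lg_n(A)$ is the set of left unimodular vectors, i.e. $(a_1,\dots,a_n)\in A^n$ with $Aa_1+\dots+Aa_n=A$, topologized as a subspace of $A^n$. $GL_n(A)$ is the group of invertible elements of $M_n(A)$, with base point the identity, acting on $Lg_n(A)$ by left multiplication; $GL_n^0(A)$ is its identity component, and $GL_0(A)=\{1\}$. The connected stable rank $csr(A)$ is the least $n\ge 1$ such that $GL_m^0(A)$ acts transitively on $Lg_m(A)$ for all $m\ge n$ (equivalently, $Lg_m(A)$ is connected for all $m\ge n$). For $k\ge 0$, $\mathrm{inj}_k(D)$ (resp. $\mathrm{surj}_k(D)$) is the least $n\ge 1$ such that the map $\pi_k(GL_{m-1}(D))\to\pi_k(GL_m(D))$ induced by $a\mapsto \begin{pmatrix} a & 0\\ 0& 1\end{pmatrix}$ is injective (resp. surjective) for all $m\ge n$. Each is $+\infty$ if no such $n$ exists. *)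

theory Defs
  imports "HOL-Analysis.Analysis"
begin

section \<open>Unital C*-algebras\<close>

text \<open>
  The base class is \<^class>\<open>real_normed_algebra\<close> together with \<^class>\<open>monoid_mult\<close>
  rather than \<^class>\<open>real_normed_algebra_1\<close>: the latter forces \<open>0 \<noteq> 1\<close>, whereas the zero
  algebra is admitted here. For a nonzero algebra \<open>norm 1 = 1\<close> follows from the C*-identity.
\<close>

class unital_cstar_algebra = real_normed_algebra + banach + monoid_mult +
  fixes scaleC :: "complex \<Rightarrow> 'a \<Rightarrow> 'a"
    and star :: "'a \<Rightarrow> 'a"
  assumes scaleC_of_real: "scaleC (complex_of_real r) x = scaleR r x"
    and scaleC_add_right: "scaleC c (x + y) = scaleC c x + scaleC c y"
    and scaleC_add_left: "scaleC (c + d) x = scaleC c x + scaleC d x"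
    and scaleC_scaleC: "scaleC c (scaleC d x) = scaleC (c * d) x"
    and mult_scaleC_left: "scaleC c x * y = scaleC c (x * y)"
    and mult_scaleC_right: "x * scaleC c y = scaleC c (x * y)"
    and norm_scaleC: "norm (scaleC c x) = cmod c * norm x"
    and star_add: "star (x + y) = star x + star y"
    and star_scaleC: "star (scaleC c x) = scaleC (cnj c) (star x)"
    and star_mult: "star (x * y) = star y * star x"
    and star_star: "star (star x) = x"
    and cstar_identity: "norm (star x * x) = (norm x)\<^sup>2"

definition unital_star_hom ::
    "('a::unital_cstar_algebra \<Rightarrow> 'b::unital_cstar_algebra) \<Rightarrow> bool" where
  "unital_star_hom f \<longleftrightarrow>
     (\<forall>x y. f (x + y) = f x + f y) \<and>
     (\<forall>c x. f (scaleC c x) = scaleC c (f x)) \<and>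
     (\<forall>x y. f (x * y) = f x * f y) \<and>
     (\<forall>x. f (star x) = star (f x)) \<and>
     f 1 = 1"


section \<open>Direct sums and pullbacks\<close>

text \<open>
  The product type already carries the Euclidean norm, which is not a C*-norm, so the
  direct sum is a separate type with componentwise operations and the maximum norm.
\<close>

datatype ('b, 'c) cstar_sum = CSum (cfst: 'b) (csnd: 'c)

lemma cstar_sum_eq_iff: "x = y \<longleftrightarrow> cfst x = cfst y \<and> csnd x = csnd y"
  by (auto intro: cstar_sum.expand)

instantiation cstar_sum :: (real_normed_vector, real_normed_vector) real_normed_vector
begin

definition "0 = CSum 0 0"
definition "x + y = CSum (cfst x + cfst y) (csnd x + csnd y)"
definition "x - y = CSum (cfst x - cfst y) (csnd x - csnd y)"
definition "- x = CSum (- cfst x) (- csnd x)"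
definition "scaleR r x = CSum (scaleR r (cfst x)) (scaleR r (csnd x))"
definition "norm x = max (norm (cfst x)) (norm (csnd x))"
definition "sgn (x :: ('a, 'b) cstar_sum) = scaleR (inverse (norm x)) x"
definition "dist (x :: ('a, 'b) cstar_sum) y = norm (x - y)"
definition "uniformity =
  (INF e\<in>{0 <..}. principal {(x :: ('a, 'b) cstar_sum, y). dist x y < e})"
definition "open (U :: ('a, 'b) cstar_sum set) \<longleftrightarrow>
  (\<forall>x\<in>U. eventually (\<lambda>(x', y). x' = x \<longrightarrow> y \<in> U) uniformity)"

lemmas cstar_sum_vector_ops =
  zero_cstar_sum_def plus_cstar_sum_def minus_cstar_sum_def uminus_cstar_sum_def
  scaleR_cstar_sum_def

instance
proof
  fix x y z :: "('a, 'b) cstar_sum" and r s :: real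
  show "x + y + z = x + (y + z)" "x + y = y + x" "0 + x = x" "- x + x = 0" "x - y = x + - y"
    by (simp_all add: cstar_sum_vector_ops add_ac)
  show "scaleR r (x + y) = scaleR r x + scaleR r y"
    "scaleR (r + s) x = scaleR r x + scaleR s x"
    "scaleR r (scaleR s x) = scaleR (r * s) x" "scaleR 1 x = x"
    by (simp_all add: cstar_sum_vector_ops scaleR_add_right scaleR_add_left)
  show "sgn x = scaleR (inverse (norm x)) x" "dist x y = norm (x - y)"
    by (simp_all add: sgn_cstar_sum_def dist_cstar_sum_def)
  show "norm x = 0 \<longleftrightarrow> x = 0"
    by (auto simp: norm_cstar_sum_def cstar_sum_vector_ops cstar_sum_eq_iff max_def
        dest: antisym[OF _ norm_ge_zero])
  show "norm (x + y) \<le> norm x + norm y"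
    using norm_triangle_ineq[of "cfst x" "cfst y"] norm_triangle_ineq[of "csnd x" "csnd y"]
    by (auto simp: norm_cstar_sum_def cstar_sum_vector_ops max_def)
  show "norm (scaleR r x) = \<bar>r\<bar> * norm x"
    by (simp add: norm_cstar_sum_def cstar_sum_vector_ops max_mult_distrib_left)
qed (rule uniformity_cstar_sum_def open_cstar_sum_def)+

end

instance cstar_sum :: (banach, banach) banach
proof
  fix X :: "nat \<Rightarrow> ('a, 'b) cstar_sum"
  assume X: "Cauchy X"
  have "Cauchy (\<lambda>n. cfst (X n))" "Cauchy (\<lambda>n. csnd (X n))"
    using X by (simp_all add: Cauchy_def dist_norm norm_cstar_sum_def minus_cstar_sum_def) meson+
  then obtain a b where "(\<lambda>n. cfst (X n)) \<longlonglongrightarrow> a" "(\<lambda>n. csnd (X n)) \<longlonglongrightarrow> b"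
    by (auto dest!: Cauchy_convergent simp: convergent_def)
  then have "(\<lambda>n. max (norm (cfst (X n) - a)) (norm (csnd (X n) - b))) \<longlonglongrightarrow> max 0 0"
    by (intro tendsto_max) (simp_all add: LIM_zero tendsto_norm_zero)
  then have "(\<lambda>n. norm (X n - CSum a b)) \<longlonglongrightarrow> 0"
    by (simp add: norm_cstar_sum_def minus_cstar_sum_def)
  then have "X \<longlonglongrightarrow> CSum a b"
    by (simp add: LIM_zero_iff tendsto_norm_zero_iff)
  then show "convergent X"
    by (auto simp: convergent_def)
qed

instantiation cstar_sum :: (unital_cstar_algebra, unital_cstar_algebra) unital_cstar_algebra
begin

definition "1 = CSum 1 1"
definition "x * y = CSum (cfst x * cfst y) (csnd x * csnd y)"
definition "scaleC c x = CSum (scaleC c (cfst x)) (scaleC c (csnd x))"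
definition "star x = CSum (star (cfst x)) (star (csnd x))"

lemmas cstar_sum_ops = cstar_sum_vector_ops
  one_cstar_sum_def times_cstar_sum_def scaleC_cstar_sum_def star_cstar_sum_def

instance
proof
  fix x y z :: "('a, 'b) cstar_sum" and r :: real and c d :: complex
  show "x * y * z = x * (y * z)" "1 * x = x" "x * 1 = x"
    by (simp_all add: cstar_sum_ops mult.assoc)
  show "(x + y) * z = x * z + y * z" "x * (y + z) = x * y + x * z"
    by (simp_all add: cstar_sum_ops algebra_simps)
  show "scaleR r x * y = scaleR r (x * y)" "x * scaleR r y = scaleR r (x * y)"
    by (simp_all add: cstar_sum_ops)
  show "scaleC (complex_of_real r) x = scaleR r x"
    "scaleC c (x + y) = scaleC c x + scaleC c y"
    "scaleC (c + d) x = scaleC c x + scaleC d x"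
    "scaleC c (scaleC d x) = scaleC (c * d) x"
    "scaleC c x * y = scaleC c (x * y)" "x * scaleC c y = scaleC c (x * y)"
    by (simp_all add: cstar_sum_ops scaleC_of_real scaleC_add_right scaleC_add_left
        scaleC_scaleC mult_scaleC_left mult_scaleC_right)
  show "star (x + y) = star x + star y" "star (scaleC c x) = scaleC (cnj c) (star x)"
    "star (x * y) = star y * star x" "star (star x) = x"
    by (simp_all add: cstar_sum_ops star_add star_scaleC star_mult star_star)
  show "norm (scaleC c x) = cmod c * norm x"
    by (simp add: norm_cstar_sum_def cstar_sum_ops norm_scaleC max_mult_distrib_left)
  have "norm (cfst x * cfst y) \<le> norm x * norm y" "norm (csnd x * csnd y) \<le> norm x * norm y"
    by (rule order_trans[OF norm_mult_ineq],
        rule mult_mono; simp add: norm_cstar_sum_def le_max_iff_disj)+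
  then show "norm (x * y) \<le> norm x * norm y"
    unfolding norm_cstar_sum_def[of "x * y"] by (simp add: times_cstar_sum_def)
  show "norm (star x * x) = (norm x)\<^sup>2"
    by (auto simp: norm_cstar_sum_def cstar_sum_ops cstar_identity max_def
        intro!: antisym power_mono dest: power2_le_imp_le)
qed

end

definition pullback ::
    "('b::unital_cstar_algebra \<Rightarrow> 'd::unital_cstar_algebra) \<Rightarrow>
     ('c::unital_cstar_algebra \<Rightarrow> 'd) \<Rightarrow> ('b, 'c) cstar_sum set" where
  "pullback \<delta> \<gamma> = {x. \<delta> (cfst x) = \<gamma> (csnd x)}"


section \<open>Unimodular vectors and invertible matrices\<close>

text \<open>
  From here on, an algebra is given by its carrier \<open>A\<close>, a unital C*-subalgebra of the
  ambient type (the pullback inside the direct sum, or the whole type). Elements of \<open>A\<^sup>n\<close> are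
  extensional functions on \<open>{..<n}\<close>, and elements of \<open>M\<^sub>n(A)\<close> are extensional functions on
  \<open>{..<n} \<times> {..<n}\<close>; the norm topology of \<open>M\<^sub>n(A)\<close> is the product topology of \<open>n\<^sup>2\<close> copies of \<open>A\<close>.
  There is exactly one matrix of size \<open>0\<close>, so \<open>GL\<^sub>0(A)\<close> is a one-point set.
\<close>

abbreviation idx :: "nat \<Rightarrow> (nat \<times> nat) set" where
  "idx n \<equiv> {..<n} \<times> {..<n}"

definition Mat_top :: "nat \<Rightarrow> 'a::unital_cstar_algebra set \<Rightarrow> (nat \<times> nat \<Rightarrow> 'a) topology" where
  "Mat_top n A = product_topology (\<lambda>_. top_of_set A) (idx n)"

definition mat_mult ::
    "nat \<Rightarrow> (nat \<times> nat \<Rightarrow> 'a::unital_cstar_algebra) \<Rightarrow> (nat \<times> nat \<Rightarrow> 'a) \<Rightarrow> nat \<times> nat \<Rightarrow> 'a" where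
  "mat_mult n a b = (\<lambda>(i, j)\<in>idx n. \<Sum>k<n. a (i, k) * b (k, j))"

definition mat_vec ::
    "nat \<Rightarrow> (nat \<times> nat \<Rightarrow> 'a::unital_cstar_algebra) \<Rightarrow> (nat \<Rightarrow> 'a) \<Rightarrow> nat \<Rightarrow> 'a" where
  "mat_vec n a v = (\<lambda>i\<in>{..<n}. \<Sum>k<n. a (i, k) * v k)"

definition mat_one :: "nat \<Rightarrow> nat \<times> nat \<Rightarrow> 'a::unital_cstar_algebra" where
  "mat_one n = (\<lambda>(i, j)\<in>idx n. if i = j then 1 else 0)"

definition GL :: "nat \<Rightarrow> 'a::unital_cstar_algebra set \<Rightarrow> (nat \<times> nat \<Rightarrow> 'a) set" where
  "GL n A = {a \<in> topspace (Mat_top n A). \<exists>b \<in> topspace (Mat_top n A).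
     mat_mult n a b = mat_one n \<and> mat_mult n b a = mat_one n}"

definition GL_top :: "nat \<Rightarrow> 'a::unital_cstar_algebra set \<Rightarrow> (nat \<times> nat \<Rightarrow> 'a) topology" where
  "GL_top n A = subtopology (Mat_top n A) (GL n A)"

definition GL0 :: "nat \<Rightarrow> 'a::unital_cstar_algebra set \<Rightarrow> (nat \<times> nat \<Rightarrow> 'a) set" where
  "GL0 n A = connected_component_of_set (GL_top n A) (mat_one n)"

definition Lg :: "nat \<Rightarrow> 'a::unital_cstar_algebra set \<Rightarrow> (nat \<Rightarrow> 'a) set" where
  "Lg n A = {a \<in> {..<n} \<rightarrow>\<^sub>E A. {\<Sum>i<n. b i * a i | b. b \<in> {..<n} \<rightarrow>\<^sub>E A} = A}"


section \<open>Homotopy groups\<close>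

text \<open>
  The underlying pointed set of \<open>\<pi>\<^sub>k(X, p)\<close>: classes of maps \<open>(I\<^sup>k, \<partial>I\<^sup>k) \<rightarrow> (X, p)\<close> under
  homotopy of such maps. The group structure is not needed to speak of injectivity and
  surjectivity. For \<open>k = 0\<close> the cube is a point with empty boundary, which gives the set of
  path components.
\<close>

definition cube :: "nat \<Rightarrow> (nat \<Rightarrow> real) topology" where
  "cube k = product_topology (\<lambda>_. top_of_set {0..1}) {..<k}"

definition cube_boundary :: "nat \<Rightarrow> (nat \<Rightarrow> real) set" where
  "cube_boundary k = {x \<in> topspace (cube k). \<exists>i<k. x i = 0 \<or> x i = 1}"

definition spheroids :: "nat \<Rightarrow> 'x topology \<Rightarrow> 'x \<Rightarrow> ((nat \<Rightarrow> real) \<Rightarrow> 'x) set" where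
  "spheroids k X p = {f. continuous_map (cube k) X f \<and> (\<forall>s\<in>cube_boundary k. f s = p)}"

definition spheroid_homotopy ::
    "nat \<Rightarrow> 'x topology \<Rightarrow> 'x \<Rightarrow> ((nat \<Rightarrow> real) \<Rightarrow> 'x) rel" where
  "spheroid_homotopy k X p = {(f, g). f \<in> spheroids k X p \<and> g \<in> spheroids k X p \<and>
     homotopic_with (\<lambda>h. \<forall>s\<in>cube_boundary k. h s = p) (cube k) X f g}"

definition homotopy_group ::
    "nat \<Rightarrow> 'x topology \<Rightarrow> 'x \<Rightarrow> ((nat \<Rightarrow> real) \<Rightarrow> 'x) set set" where
  "homotopy_group k X p = spheroids k X p // spheroid_homotopy k X p"

text \<open>The map induced by a continuous map \<open>h\<close> into \<open>Y\<close> with \<open>h p = q\<close>, where \<open>p\<close> is the base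
  point of the source.\<close>

definition homotopy_group_map ::
    "nat \<Rightarrow> 'y topology \<Rightarrow> 'y \<Rightarrow> ('x \<Rightarrow> 'y) \<Rightarrow>
     ((nat \<Rightarrow> real) \<Rightarrow> 'x) set \<Rightarrow> ((nat \<Rightarrow> real) \<Rightarrow> 'y) set" where
  "homotopy_group_map k Y q h c = spheroid_homotopy k Y q `` ((\<lambda>f. h \<circ> f) ` c)"


section \<open>Stable ranks\<close>

definition least_stable :: "(nat \<Rightarrow> bool) \<Rightarrow> enat" where
  "least_stable P = Inf (enat ` {n. n \<ge> 1 \<and> (\<forall>m\<ge>n. P m)})"

definition csr :: "'a::unital_cstar_algebra set \<Rightarrow> enat" where
  "csr A = least_stable (\<lambda>m. \<forall>x\<in>Lg m A. \<forall>y\<in>Lg m A. \<exists>g\<in>GL0 m A. mat_vec m g x = y)"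

text \<open>The map \<open>a \<mapsto> diag(a, 1)\<close> from \<open>n \<times> n\<close> to \<open>(n + 1) \<times> (n + 1)\<close> matrices.\<close>

definition mat_embed :: "nat \<Rightarrow> (nat \<times> nat \<Rightarrow> 'a::unital_cstar_algebra) \<Rightarrow> nat \<times> nat \<Rightarrow> 'a" where
  "mat_embed n a = (\<lambda>(i, j)\<in>idx (Suc n).
     if i < n \<and> j < n then a (i, j) else if i = j then 1 else 0)"

definition GL_homotopy_group ::
    "nat \<Rightarrow> nat \<Rightarrow> 'a::unital_cstar_algebra set \<Rightarrow> ((nat \<Rightarrow> real) \<Rightarrow> nat \<times> nat \<Rightarrow> 'a) set set" where
  "GL_homotopy_group k n A = homotopy_group k (GL_top n A) (mat_one n)"

definition GL_stabilization ::
    "nat \<Rightarrow> nat \<Rightarrow> 'a::unital_cstar_algebra set \<Rightarrow>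
     ((nat \<Rightarrow> real) \<Rightarrow> nat \<times> nat \<Rightarrow> 'a) set \<Rightarrow> ((nat \<Rightarrow> real) \<Rightarrow> nat \<times> nat \<Rightarrow> 'a) set" where
  "GL_stabilization k m A =
     homotopy_group_map k (GL_top m A) (mat_one m) (mat_embed (m - 1))"

definition inj_rank :: "nat \<Rightarrow> 'a::unital_cstar_algebra set \<Rightarrow> enat" where
  "inj_rank k A =
     least_stable (\<lambda>m. inj_on (GL_stabilization k m A) (GL_homotopy_group k (m - 1) A))"

definition surj_rank :: "nat \<Rightarrow> 'a::unital_cstar_algebra set \<Rightarrow> enat" where
  "surj_rank k A =
     least_stable (\<lambda>m. GL_stabilization k m A ` GL_homotopy_group k (m - 1) A
       = GL_homotopy_group k m A)"

end

theory Submission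
  imports Defs
begin

text \<open>
  Given a unimodular vector over the pullback, \<open>b \<in> GL\<^sub>m\<^sup>0(B)\<close> and \<open>c \<in> GL\<^sub>m\<^sup>0(C)\<close> move its two
  components to the last unit vector. Then \<open>\<delta>(b) \<gamma>(c)\<^sup>-\<^sup>1\<close> lies in \<open>GL\<^sub>m\<^sup>0(D)\<close> and fixes the last
  unit vector; by injectivity on \<open>\<pi>\<^sub>0\<close> its upper left corner is in \<open>GL\<^sub>m\<^sub>-\<^sub>1\<^sup>0(D)\<close>, so that it
  lifts to an element of \<open>GL\<^sub>m\<^sup>0(C)\<close> fixing the last unit vector, and correcting \<open>c\<close> by this lift
  makes \<open>(b, c)\<close> an invertible matrix over the pullback. To connect it to the identity there,
  choose paths \<open>b\<^sub>t\<close> and \<open>c\<^sub>t\<close>. By surjectivity on \<open>\<pi>\<^sub>1\<close> the loop \<open>\<delta>(b\<^sub>t) \<gamma>(c\<^sub>t)\<^sup>-\<^sup>1\<close> is homotopic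
  to a loop in \<open>GL\<^sub>m\<^sub>-\<^sub>1(D)\<close>; lifting that loop to a path and the homotopy along with it changes \<open>c\<close>
  only by an element that fixes the last unit vector and is trivial in \<open>D\<close>. The lifts exist
  because a surjection of Banach spaces admits bounded lifts of continuous paths.
\<close>


section \<open>Unital *-homomorphisms are contractive\<close>

text \<open>The paths \<open>b\<^sub>t\<close> and \<open>c\<^sub>t\<close> agree in
  \<open>D\<close> only at their ends, so together they are not a path over the pullback; the loop
  measures this defect. Lifting the loop directly to \<open>C\<close> would end at some element over
  1 about which nothing else is known, and multiplying by it could move the last unit vector.
  Deforming the loop into the corner cures this: the corner loop also lifts only to a path, whose
  end \<open>k\<close> need not be 1, but diag(\<open>k\<close>, 1) fixes the last unit vector. For
  this end to survive the homotopy, the lift must stay put where the homotopy is stationary, which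
  is why path lifts are taken relative to the endpoints. Norm bounds matter because a matrix at
  distance less than 1 from the identity is invertible: small additive lifts give invertible lifts,
  and a homotopy is cut into steps that small. The morphisms are given algebraically; contractivity
  supplies the continuity on which all of this rests.\<close>

lemma star_one [simp]: "star (1::'a::unital_cstar_algebra) = 1"
  by (metis mult_1_right star_mult star_star)

text \<open>Equality fails in the zero algebra, where 1 = 0; the C*-identity at 1 only says that the
  norm of 1 is 0 or 1.\<close>

lemma norm_one_le: "norm (1::'a::unital_cstar_algebra) \<le> 1"
proof -
  have "norm (1::'a) * (norm (1::'a) - 1) = 0"
    using cstar_identity[of "1::'a"] by (simp add: power2_eq_square algebra_simps)
  then show ?thesis by auto
qed

lemma norm_star [simp]: "norm (star (x::'a::unital_cstar_algebra)) = norm x"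
proof -
  have le: "norm y \<le> norm (star y)" for y :: 'a
  proof -
    have "norm y * norm y \<le> norm (star y) * norm y"
      using norm_mult_ineq[of "star y" y] cstar_identity[of y] by (simp add: power2_eq_square)
    then show ?thesis by (cases "norm y = 0") (auto simp: mult_le_cancel_right)
  qed
  show ?thesis using le[of x] le[of "star x"] by (simp add: star_star)
qed

lemma star_scaleR: "star (scaleR r (x::'a::unital_cstar_algebra)) = scaleR r (star x)"
  using star_scaleC[of "complex_of_real r" x] by (simp add: scaleC_of_real)

lemma star_diff: "star (x - y :: 'a::unital_cstar_algebra) = star x - star y"
  using star_add[of "x - y" y] by (simp add: algebra_simps)

lemma bounded_linear_star: "bounded_linear (star :: 'a::unital_cstar_algebra \<Rightarrow> 'a)"
  by (rule bounded_linear_intro[where K=1]) (simp_all add: star_add star_scaleR)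

lemma star_homD:
  assumes "unital_star_hom f"
  shows "f (x + y) = f x + f y" "f (scaleC c x) = scaleC c (f x)" "f (x * y) = f x * f y"
    "f (star x) = star (f x)" "f 1 = 1" "f (scaleR r x) = scaleR r (f x)" "f 0 = 0"
    "f (x - y) = f x - f y"
proof -
  note f = assms[unfolded unital_star_hom_def]
  show *: "f (x + y) = f x + f y" "f (scaleC c x) = scaleC c (f x)" "f (x * y) = f x * f y"
    "f (star x) = star (f x)" "f 1 = 1" for x y c
    using f by auto
  show "f (scaleR r x) = scaleR r (f x)"
    by (metis *(2) scaleC_of_real)
  show "f 0 = 0" using *(1)[of 0 0] by simp
  show "f (x - y) = f x - f y" using *(1)[of "x - y" y] by (simp add: algebra_simps)
qed

text \<open>The square root of \<open>1 - a\<^sup>2\<close> is \<open>1 - y\<close>, where \<open>y\<close> is the fixed point of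
  \<open>y \<mapsto> (a\<^sup>2 + y\<^sup>2) / 2\<close>.\<close>

lemma selfadjoint_sqrt:
  fixes a :: "'a::unital_cstar_algebra"
  assumes sa: "star a = a" and na: "norm a < 1"
  obtains s where "star s = s" "s * a = a * s" "a * a + s * s = 1"
proof -
  \<comment> \<open>Commuting with \<open>a\<close>, self-adjointness and the norm bound are closed
    conditions preserved by \<open>f\<close>, so the fixed point inherits them; on \<open>S\<close>
    the map \<open>f\<close> contracts by the factor \<open>norm a\<close>.\<close>
  define S where "S = {y. y * a = a * y \<and> star y = y \<and> norm y \<le> norm a}"
  define f where "f y = (1/2) *\<^sub>R (a * a + y * y)" for y
  have "closed S"
    unfolding S_def
    by (intro closed_Collect_conj closed_Collect_eq closed_Collect_le continuous_intros
        bounded_linear.continuous_on[OF bounded_linear_star])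
  then have "complete S" by (simp add: complete_eq_closed)
  moreover have "0 \<in> S"
    using star_diff[of 0 "0::'a"] by (auto simp: S_def)
  moreover have "f ` S \<subseteq> S"
  proof (clarsimp simp: S_def)
    fix y assume y: "y * a = a * y" "star y = y" "norm y \<le> norm a"
    have "norm (a * a + y * y) \<le> norm a * norm a + norm y * norm y"
      by (intro norm_triangle_le add_mono norm_mult_ineq)
    also have "\<dots> \<le> norm a * 1 + norm a * 1"
      using y na by (intro add_mono mult_mono) auto
    finally have "norm (f y) \<le> norm a" by (simp add: f_def)
    moreover have "f y * a = a * f y"
      using y by (simp add: f_def algebra_simps) (metis mult.assoc)
    moreover have "star (f y) = f y"
      using y sa by (simp add: f_def star_scaleR star_add star_mult)
    ultimately show "f y * a = a * f y \<and> star (f y) = f y \<and> norm (f y) \<le> norm a"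
      by blast
  qed
  moreover have "dist (f x) (f y) \<le> norm a * dist x y" if "x \<in> S" "y \<in> S" for x y
  proof -
    have "f x - f y = (1/2) *\<^sub>R (x * (x - y) + (x - y) * y)"
      by (simp add: f_def algebra_simps)
    then have "dist (f x) (f y) = (1/2) * norm (x * (x - y) + (x - y) * y)"
      by (simp add: dist_norm)
    also have "\<dots> \<le> (1/2) * (norm x * norm (x - y) + norm (x - y) * norm y)"
      by (intro mult_left_mono norm_triangle_le add_mono norm_mult_ineq) auto
    also have "\<dots> \<le> (1/2) * (norm a * norm (x - y) + norm (x - y) * norm a)"
      using that by (intro mult_left_mono add_mono mult_mono) (auto simp: S_def)
    finally show ?thesis by (simp add: dist_norm)
  qed
  ultimately obtain y where y: "y \<in> S" "f y = y"
    using Banach_fix[of S "norm a" f] na by auto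
  have eq: "a * a + y * y = y + y"
  proof -
    have "2 *\<^sub>R f y = a * a + y * y" by (simp add: f_def)
    then show ?thesis using y(2) by (simp add: scaleR_2)
  qed
  show ?thesis
  proof (rule that[of "1 - y"])
    show "star (1 - y) = 1 - y" "(1 - y) * a = a * (1 - y)"
      using y(1) by (simp_all add: S_def star_diff algebra_simps)
    have "a * a + (1 - y) * (1 - y) = 1 - (y + y) + (a * a + y * y)"
      by (simp add: algebra_simps)
    then show "a * a + (1 - y) * (1 - y) = 1" using eq by simp
  qed
qed

text \<open>A self-adjoint \<open>a\<close> of norm less than 1 is the real part of the unitary
  \<open>a + i (1 - a\<^sup>2)\<^sup>1\<^sup>/\<^sup>2\<close>, and unitaries are mapped to unitaries.\<close>

lemma star_hom_norm_le_one:
  assumes f: "unital_star_hom f" and sa: "star a = a" and na: "norm a < 1"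
  shows "norm (f a) \<le> 1"
proof -
  obtain s where s: "star s = s" "s * a = a * s" "a * a + s * s = 1"
    using selfadjoint_sqrt[OF sa na] .
  define u where "u = a + scaleC \<i> s"
  have min: "scaleC (-1) x = - x" for x :: 'a
    using scaleC_of_real[of "-1" x] by simp
  have one: "scaleC 1 x = x" for x :: 'a
    using scaleC_of_real[of 1 x] by simp
  have "scaleC (-\<i>) x = - scaleC \<i> x" for x :: 'a
    using scaleC_scaleC[of "-1" \<i> x] min by simp
  then have su: "star u = a - scaleC \<i> s"
    using s sa by (simp add: u_def star_add star_scaleC)
  have "star u * u = a * (a + scaleC \<i> s) - scaleC \<i> (s * (a + scaleC \<i> s))"
    by (simp only: su) (simp add: u_def left_diff_distrib mult_scaleC_left)
  also have "\<dots> = a * a - scaleC (\<i>*\<i>) (s * s)"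
    using s(2) by (simp add: distrib_left mult_scaleC_right scaleC_add_right scaleC_scaleC)
  finally have "star u * u = a * a - scaleC (\<i>*\<i>) (s * s)" .
  then have "star u * u = 1" using s(3) min by simp
  then have "star (f u) * f u = 1"
    using star_homD[OF f] by metis
  then have "(norm (f u))\<^sup>2 \<le> 1"
    using cstar_identity[of "f u"] norm_one_le[where 'a='b] by simp
  then have fu: "norm (f u) \<le> 1"
    by (simp add: power_le_one_iff abs_square_le_1)
  have "u + star u = 2 *\<^sub>R a"
    by (simp only: su) (simp add: u_def scaleR_2)
  then have "2 *\<^sub>R f a = f (u + star u)"
    by (simp add: star_homD(6)[OF f])
  also have "\<dots> = f u + star (f u)" by (simp add: star_homD[OF f])
  finally have "2 * norm (f a) = norm (f u + star (f u))"
    by (metis abs_numeral norm_scaleR)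
  also have "\<dots> \<le> 2"
    using norm_triangle_ineq[of "f u" "star (f u)"] fu by simp
  finally show ?thesis by simp
qed

text \<open>The C*-identity reduces the bound to the self-adjoint element \<open>star x * x\<close>,
  and scaling reduces self-adjoint elements to the open unit ball. This is where the continuity of a
  morphism defined by algebraic conditions comes from.\<close>

lemma star_hom_norm_le:
  assumes f: "unital_star_hom f"
  shows "norm (f x) \<le> norm x"
proof -
  have sa: "norm (f x) \<le> norm x" if x: "star x = x" for x
  proof (rule field_le_epsilon)
    fix e :: real assume "e > 0"
    define r where "r = norm x + e"
    have r: "r > 0" "norm x < r" using \<open>e > 0\<close> by (auto simp: r_def add_nonneg_pos)
    have "norm (f ((1/r) *\<^sub>R x)) \<le> 1"
      by (rule star_hom_norm_le_one[OF f]) (use r x in \<open>auto simp: star_scaleR\<close>)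
    then show "norm (f x) \<le> norm x + e"
      using r by (simp add: star_homD(6)[OF f] r_def[symmetric])
  qed
  have "(norm (f x))\<^sup>2 = norm (f (star x * x))"
    by (simp add: star_homD[OF f] cstar_identity)
  also have "\<dots> \<le> norm (star x * x)"
    by (rule sa) (simp add: star_mult star_star)
  also have "\<dots> = (norm x)\<^sup>2" by (rule cstar_identity)
  finally show ?thesis by (rule power2_le_imp_le) simp
qed

lemma bounded_linear_star_hom: "unital_star_hom f \<Longrightarrow> bounded_linear f"
  by (rule bounded_linear_intro[where K=1]) (simp_all add: star_homD star_hom_norm_le)


section \<open>Lifting continuous paths through a surjection of Banach spaces\<close>

text \<open>The Baire half of the open mapping theorem: the closure of the image of some ball has
  interior. It yields lifts only up to an error, but with a bound linear in \<open>norm d\<close>,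
  and the later iteration lives on that uniformity.\<close>

lemma surjection_approx_lift:
  fixes g :: "'a::banach \<Rightarrow> 'b::banach"
  assumes g: "bounded_linear g" and surj: "surj g"
  obtains M where "M > 0"
    "\<And>d e. e > 0 \<Longrightarrow> \<exists>c. norm c \<le> M * norm d \<and> norm (g c - d) < e"
proof -
  interpret g: bounded_linear g by fact
  define C where "C n = closure (g ` cball 0 (real n))" for n
  have "(\<Union>n. C n) = UNIV"
  proof -
    have "y \<in> (\<Union>n. C n)" for y
    proof -
      obtain x where "y = g x" using surj by auto
      moreover obtain n where "norm x \<le> real n" using real_arch_simple by blast
      ultimately have "y \<in> g ` cball 0 (real n)" by auto
      then have "y \<in> C n" unfolding C_def by (rule subsetD[OF closure_subset])
      then show ?thesis by blast
    qed
    then show ?thesis by auto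
  qed
  moreover have "euclidean interior_of \<Union>(range C) = {}" if "\<And>n. interior (C n) = {}"
    by (rule Baire_category_alt)
      (use that in \<open>auto simp: completely_metrizable_space_euclidean C_def simp flip: closed_closedin\<close>)
  ultimately obtain n where "interior (C n) \<noteq> {}" by auto
  then obtain z \<rho> where \<rho>: "\<rho> > 0" "ball z \<rho> \<subseteq> C n"
    by (meson all_not_in_conv mem_interior)
  \<comment> \<open>Approximating both \<open>z + u\<close> and \<open>z\<close> and subtracting
    removes the centre \<open>z\<close>, at the price of doubling the radius
    \<open>n\<close>.\<close>
  have approx: "\<exists>c. norm c \<le> 2 * real n \<and> norm (g c - u) < e" if "norm u < \<rho>" "e > 0" for u e
  proof -
    have near: "\<exists>c. norm c \<le> real n \<and> dist (g c) w < e/2" if "w \<in> C n" for w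
    proof -
      have "e / 2 > 0" using \<open>e > 0\<close> by simp
      then have "\<exists>y\<in>g ` cball 0 (real n). dist y w < e/2"
        using that unfolding C_def closure_approachable by blast
      then show ?thesis by auto
    qed
    have "z + u \<in> C n" "z \<in> C n" using \<rho> that by (auto simp: dist_norm)
    then obtain c1 c2 where c: "norm c1 \<le> real n" "dist (g c1) (z + u) < e/2"
      "norm c2 \<le> real n" "dist (g c2) z < e/2"
      using near[of "z + u"] near[of z] by blast
    have "norm (c1 - c2) \<le> 2 * real n"
      using c norm_triangle_ineq4[of c1 c2] by simp
    moreover have "norm (g (c1 - c2) - u) < e"
    proof -
      have eq: "g (c1 - c2) - u = (g c1 - (z + u)) - (g c2 - z)"
        by (simp add: g.diff)
      show ?thesis
        unfolding eq using c(2,4) norm_triangle_ineq4[of "g c1 - (z + u)" "g c2 - z"]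
        unfolding dist_norm by linarith
    qed
    ultimately show ?thesis by blast
  qed
  show ?thesis
  \<comment> \<open>Undoing the scaling of \<open>d\<close> to norm \<rho>/2 multiplies the bound 2
    \<open>n\<close> by 2 \<open>norm d\<close> / \<rho>; \<open>Suc n\<close> makes the constant
    positive.\<close>
  proof (rule that[of "4 * real (Suc n) / \<rho>"])
    show "4 * real (Suc n) / \<rho> > 0" using \<rho> by simp
    fix d :: 'b and e :: real assume e: "e > 0"
    show "\<exists>c. norm c \<le> 4 * real (Suc n) / \<rho> * norm d \<and> norm (g c - d) < e"
    proof (cases "d = 0")
      case True
      then show ?thesis using e by (intro exI[of _ 0]) (auto simp: g.zero)
    next
      case False
      define k where "k = \<rho> / (2 * norm d)"
      have k: "k > 0" "norm (k *\<^sub>R d) < \<rho>" using \<rho> False by (auto simp: k_def)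
      obtain c where c: "norm c \<le> 2 * real n" "norm (g c - k *\<^sub>R d) < k * e"
        using approx[OF k(2), of "k * e"] k e by auto
      have "norm ((1/k) *\<^sub>R c) \<le> (1/k) * (2 * real (Suc n))"
        using c k by (simp add: divide_right_mono)
      also have "\<dots> = 4 * real (Suc n) / \<rho> * norm d"
        using False \<rho> by (simp add: k_def field_simps)
      finally have "norm ((1/k) *\<^sub>R c) \<le> \<dots>" .
      moreover have "norm (g ((1/k) *\<^sub>R c) - d) < e"
      proof -
        have "g ((1/k) *\<^sub>R c) - d = (1/k) *\<^sub>R (g c - k *\<^sub>R d)"
          using k by (simp add: g.scaleR algebra_simps)
        then have "norm (g ((1/k) *\<^sub>R c) - d) = norm (g c - k *\<^sub>R d) / k"
          using k by simp
        also have "\<dots> < e" using c(2) k by (simp add: field_simps)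
        finally show ?thesis .
      qed
      ultimately show ?thesis by blast
    qed
  qed
qed

text \<open>A partition of unity subordinate to a fine cover of the compact domain patches
  together approximate lifts of finitely many values.\<close>

lemma path_approx_lift:
  fixes g :: "'a::banach \<Rightarrow> 'b::banach" and x :: "'t::metric_space \<Rightarrow> 'b"
  assumes g: "bounded_linear g"
    and lift: "\<And>d e. e > 0 \<Longrightarrow> \<exists>c. norm c \<le> M * norm d \<and> norm (g c - d) < e"
    and M: "M > 0" and T: "compact T" and x: "continuous_on T x"
    and r: "r > 0" "\<And>t. t \<in> T \<Longrightarrow> norm (x t) \<le> r"
  shows "\<exists>y. continuous_on T y \<and> (\<forall>t\<in>T. norm (y t) \<le> M * r \<and> norm (x t - g (y t)) \<le> r / 2)"
proof -
  interpret g: bounded_linear g by fact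
  \<comment> \<open>The final error r/2 splits into r/4 from the oscillation of \<open>x\<close> on
    a ball and r/4 from the lift at its centre.\<close>
  have "r / 4 > 0" using r(1) by simp
  then obtain \<delta> where \<delta>: "\<delta> > 0"
    "\<And>s t. s \<in> T \<Longrightarrow> t \<in> T \<Longrightarrow> dist t s < \<delta> \<Longrightarrow> dist (x t) (x s) < r / 4"
    using uniformly_continuous_onE[OF compact_uniformly_continuous[OF x T]] by blast
  obtain K where K: "finite K" "K \<subseteq> T" "T \<subseteq> (\<Union>k\<in>K. ball k \<delta>)"
    using seq_compact_imp_totally_bounded[OF compact_imp_seq_compact[OF T]] \<delta>(1) by metis
  have "\<forall>k. \<exists>c. norm c \<le> M * norm (x k) \<and> norm (g c - x k) < r / 4"
    using lift[of "r/4"] r(1) by simp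
  then obtain c where c: "\<And>k. norm (c k) \<le> M * norm (x k)" "\<And>k. norm (g (c k) - x k) < r / 4"
    by metis
  \<comment> \<open>Tent functions: the weight vanishes unless \<open>t\<close> lies within \<delta>
    of \<open>k\<close>, so only lifts of nearby values contribute to \<open>y t\<close>.\<close>
  define \<psi> where "\<psi> k t = max 0 (\<delta> - dist t k)" for k t :: 't
  define \<Psi> where "\<Psi> t = (\<Sum>k\<in>K. \<psi> k t)" for t
  have \<psi>0: "\<psi> k t \<ge> 0" for k t by (simp add: \<psi>_def)
  have pos: "\<Psi> t > 0" if "t \<in> T" for t
  proof -
    obtain k where "k \<in> K" "dist t k < \<delta>" using K(3) \<open>t \<in> T\<close> by (auto simp: dist_commute)
    then show ?thesis unfolding \<Psi>_def
      by (intro sum_pos2[OF K(1), of k]) (auto simp: \<psi>_def)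
  qed
  define y where "y t = (1 / \<Psi> t) *\<^sub>R (\<Sum>k\<in>K. \<psi> k t *\<^sub>R c k)" for t
  have "continuous_on T y"
    unfolding y_def \<Psi>_def \<psi>_def
    by (intro continuous_intros) (use pos in \<open>auto simp: \<Psi>_def \<psi>_def less_le\<close>)
  moreover have "norm (y t) \<le> M * r" if t: "t \<in> T" for t
  proof -
    have "norm (\<Sum>k\<in>K. \<psi> k t *\<^sub>R c k) \<le> (\<Sum>k\<in>K. \<psi> k t * (M * r))"
    proof (rule sum_norm_le)
      fix k assume "k \<in> K"
      have "norm (c k) \<le> M * r"
        using c(1)[of k] r(2)[of k] \<open>k \<in> K\<close> K(2) M by (meson mult_le_cancel_left_pos order_trans subsetD)
      then show "norm (\<psi> k t *\<^sub>R c k) \<le> \<psi> k t * (M * r)"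
        using \<psi>0 by (simp add: mult_left_mono)
    qed
    also have "\<dots> = \<Psi> t * (M * r)" by (simp add: \<Psi>_def sum_distrib_right)
    finally show ?thesis using pos[OF t] by (simp add: y_def field_simps)
  qed
  moreover have "norm (x t - g (y t)) \<le> r / 2" if t: "t \<in> T" for t
  proof -
    have eq: "\<Psi> t *\<^sub>R x t - (\<Sum>k\<in>K. \<psi> k t *\<^sub>R g (c k)) = (\<Sum>k\<in>K. \<psi> k t *\<^sub>R (x t - g (c k)))"
      by (simp add: \<Psi>_def scaleR_left.sum sum_subtractf scaleR_diff_right)
    have le: "norm (\<Sum>k\<in>K. \<psi> k t *\<^sub>R (x t - g (c k))) \<le> (\<Sum>k\<in>K. \<psi> k t * (r / 2))"
    proof (rule sum_norm_le)
      fix k assume k: "k \<in> K"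
      show "norm (\<psi> k t *\<^sub>R (x t - g (c k))) \<le> \<psi> k t * (r / 2)"
      proof (cases "dist t k < \<delta>")
        case True
        then have "norm (x t - x k) < r / 4"
          using \<delta>(2)[of k t] t k K(2) by (auto simp: dist_norm)
        then have "norm (x t - g (c k)) \<le> r / 2"
          using c(2)[of k] norm_triangle_ineq[of "x t - x k" "x k - g (c k)"]
          by (simp add: norm_minus_commute)
        then show ?thesis
          unfolding norm_scaleR abs_of_nonneg[OF \<psi>0] by (rule mult_left_mono) (rule \<psi>0)
      next
        case False
        then show ?thesis by (simp add: \<psi>_def)
      qed
    qed
    have sum: "(\<Sum>k\<in>K. \<psi> k t * (r / 2)) = \<Psi> t * (r / 2)"
      by (simp only: \<Psi>_def sum_distrib_right)
    have "x t - g (y t) = (1 / \<Psi> t) *\<^sub>R (\<Psi> t *\<^sub>R x t - (\<Sum>k\<in>K. \<psi> k t *\<^sub>R g (c k)))"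
      using pos[OF t] by (simp add: y_def g.scaleR g.sum algebra_simps)
    then have "norm (x t - g (y t)) = norm (\<Sum>k\<in>K. \<psi> k t *\<^sub>R (x t - g (c k))) / \<Psi> t"
      unfolding eq using pos[OF t] by simp
    also have "\<dots> \<le> \<Psi> t * (r / 2) / \<Psi> t"
      using le pos[OF t] unfolding sum by (intro divide_right_mono) auto
    also have "\<dots> = r / 2" using pos[OF t] by simp
    finally show ?thesis .
  qed
  ultimately show ?thesis by blast
qed

text \<open>The approximate lift is applied again and again to the remaining error. The error bound
  halves each time, so the corrections are dominated by a geometric series and converge uniformly to
  a continuous lift, with total bound twice that of the first correction.\<close>

lemma path_exact_lift:
  fixes g :: "'a::banach \<Rightarrow> 'b::banach"
  assumes g: "bounded_linear g" and surj: "surj g"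
  obtains M where "M > 0"
    "\<And>(T :: 't::metric_space set) x r. compact T \<Longrightarrow> continuous_on T x \<Longrightarrow> r > 0 \<Longrightarrow>
      (\<And>t. t \<in> T \<Longrightarrow> norm (x t) \<le> r) \<Longrightarrow>
      \<exists>y. continuous_on T y \<and> (\<forall>t\<in>T. norm (y t) \<le> M * r \<and> g (y t) = x t)"
proof -
  interpret g: bounded_linear g by fact
  obtain M where M: "M > 0"
    "\<And>d e. e > 0 \<Longrightarrow> \<exists>c. norm c \<le> M * norm d \<and> norm (g c - d) < e"
    using surjection_approx_lift[OF g surj] by blast
  show ?thesis
  proof (rule that[of "2 * M"])
    show "2 * M > 0" using M by simp
    fix T :: "'t set" and x :: "'t \<Rightarrow> 'b" and r :: real
    assume T: "compact T" and x: "continuous_on T x" and r: "r > 0" "\<And>t. t \<in> T \<Longrightarrow> norm (x t) \<le> r"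
    define P where "P n z \<longleftrightarrow> continuous_on T z \<and> (\<forall>t\<in>T. norm (z t) \<le> r / 2 ^ n)"
      for n and z :: "'t \<Rightarrow> 'b"
    have "\<exists>y. continuous_on T y \<and> (\<forall>t\<in>T. norm (y t) \<le> M * (r / 2 ^ n)) \<and> P (Suc n) (\<lambda>t. z t - g (y t))"
      if z: "P n z" for n z
    proof -
      obtain y where "continuous_on T y"
        "\<forall>t\<in>T. norm (y t) \<le> M * (r / 2 ^ n) \<and> norm (z t - g (y t)) \<le> r / 2 ^ n / 2"
        using path_approx_lift[OF g M(2) M(1) T, of z "r / 2 ^ n"] z r(1) unfolding P_def by auto
      then show ?thesis using z
        by (intro exI[of _ y]) (auto simp: P_def mult.commute intro!: continuous_intros g.continuous_on)
    qed
    then obtain Y where Y: "\<And>n z. P n z \<Longrightarrow> continuous_on T (Y n z)"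
      "\<And>n z t. P n z \<Longrightarrow> t \<in> T \<Longrightarrow> norm (Y n z t) \<le> M * (r / 2 ^ n)"
      "\<And>n z. P n z \<Longrightarrow> P (Suc n) (\<lambda>t. z t - g (Y n z t))"
      by metis
    define X where "X = rec_nat x (\<lambda>n z t. z t - g (Y n z t))"
    have X0: "X 0 = x" and XS: "\<And>n. X (Suc n) = (\<lambda>t. X n t - g (Y n (X n) t))"
      by (simp_all add: X_def)
    have P: "P n (X n)" for n
      by (induction n) (use x r Y(3) in \<open>auto simp: X0 XS P_def\<close>)
    define y where "y t = (\<Sum>n. Y n (X n) t)" for t
    have bnd: "norm (Y n (X n) t) \<le> M * r * (1/2) ^ n" if "t \<in> T" for n t
      using Y(2)[OF P that, of n] by (simp add: power_one_over field_simps)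
    have geo: "summable (\<lambda>n. M * r * (1/2) ^ n)"
      by (intro summable_mult summable_geometric) simp
    have sm: "summable (\<lambda>n. Y n (X n) t)" if "t \<in> T" for t
      by (rule summable_comparison_test'[OF geo, of 0]) (use bnd that in auto)
    have "uniform_limit T (\<lambda>n t. \<Sum>i<n. Y i (X i) t) y sequentially"
      unfolding y_def by (rule Weierstrass_m_test[OF _ geo]) (use bnd in auto)
    then have "continuous_on T y"
      by (rule uniform_limit_theorem[rotated]) (auto intro!: continuous_on_sum Y(1) P always_eventually)
    moreover have "norm (y t) \<le> 2 * M * r" if t: "t \<in> T" for t
    proof -
      have "norm (y t) \<le> (\<Sum>n. M * r * (1/2) ^ n)"
        unfolding y_def by (rule norm_suminf_le[OF bnd[OF t] geo])
      also have "\<dots> = 2 * M * r"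
        using suminf_mult[of "\<lambda>n. (1/2::real) ^ n" "M * r"] suminf_geometric[of "1/2::real"]
        by (simp add: summable_geometric)
      finally show ?thesis .
    qed
    moreover have "g (y t) = x t" if t: "t \<in> T" for t
    proof -
      have "(\<lambda>n. X n t) \<longlonglongrightarrow> 0"
      proof (rule Lim_null_comparison)
        show "\<forall>\<^sub>F n in sequentially. norm (X n t) \<le> r * (1/2) ^ n"
          using P t by (auto simp: P_def power_one_over)
        show "(\<lambda>n. r * (1/2) ^ n) \<longlonglongrightarrow> 0"
          by (intro tendsto_mult_right_zero LIMSEQ_power_zero) simp
      qed
      \<comment> \<open>Each \<open>g (Y n (X n) t)\<close> is the drop from one error to the next,
        so the series telescopes to the initial error \<open>x t\<close>.\<close>
      from telescope_sums'[OF this] have "(\<lambda>n. g (Y n (X n) t)) sums x t"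
        by (simp add: XS X0)
      moreover have "(\<lambda>n. g (Y n (X n) t)) sums g (y t)"
        unfolding y_def by (intro g.sums summable_sums sm t)
      ultimately show ?thesis by (rule sums_unique2[symmetric])
    qed
    ultimately show "\<exists>y. continuous_on T y \<and> (\<forall>t\<in>T. norm (y t) \<le> 2 * M * r \<and> g (y t) = x t)"
      by blast
  qed
qed

text \<open>Subtracting an affine path makes the lift vanish at the endpoints where the given
  path does.\<close>

lemma path_lift_rel_endpoints:
  fixes g :: "'a::banach \<Rightarrow> 'b::banach"
  assumes g: "bounded_linear g" and surj: "surj g"
  obtains M where "M > 0"
    "\<And>(x :: real \<Rightarrow> 'b) r. continuous_on {0..1} x \<Longrightarrow> r > 0 \<Longrightarrow>
      (\<And>t. t \<in> {0..1} \<Longrightarrow> norm (x t) \<le> r) \<Longrightarrow>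
      \<exists>y. continuous_on {0..1} y \<and> (\<forall>t\<in>{0..1}. norm (y t) \<le> M * r \<and> g (y t) = x t) \<and>
        (\<forall>t\<in>{0,1}. x t = 0 \<longrightarrow> y t = 0)"
proof -
  interpret g: bounded_linear g by fact
  obtain M where M: "M > 0"
    "\<And>(T :: real set) x r. compact T \<Longrightarrow> continuous_on T x \<Longrightarrow> r > 0 \<Longrightarrow>
      (\<And>t. t \<in> T \<Longrightarrow> norm (x t) \<le> r) \<Longrightarrow>
      \<exists>y. continuous_on T y \<and> (\<forall>t\<in>T. norm (y t) \<le> M * r \<and> g (y t) = x t)"
    using path_exact_lift[OF g surj] by metis
  show ?thesis
  proof (rule that[of "3 * M"])
    show "3 * M > 0" using M by simp
    fix x :: "real \<Rightarrow> 'b" and r :: real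
    assume "continuous_on {0..1} x" "r > 0" "\<And>t. t \<in> {0..1} \<Longrightarrow> norm (x t) \<le> r"
    from M(2)[OF compact_Icc this] obtain y where y: "continuous_on {0..1} y"
      "\<And>t. t \<in> {0..1} \<Longrightarrow> norm (y t) \<le> M * r" "\<And>t. t \<in> {0..1} \<Longrightarrow> g (y t) = x t"
      by auto
    \<comment> \<open>Where \<open>x\<close> vanishes at an endpoint, \<open>y\<close> lies in the
      kernel of \<open>g\<close>, so subtracting the affine interpolation of these values leaves
      \<open>g (y t)\<close> unchanged. The two endpoint terms and \<open>y\<close> itself give the
      factor 3.\<close>
    define a where "a t = (if x t = 0 then y t else 0)" for t
    have a: "g (a t) = 0" "norm (a t) \<le> M * r" if "t \<in> {0,1}" for t
      using that y(2,3)[of t] M(1) \<open>r > 0\<close> by (auto simp: a_def g.zero)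
    define z where "z t = y t - ((1 - t) *\<^sub>R a 0 + t *\<^sub>R a 1)" for t
    have "continuous_on {0..1} z"
      unfolding z_def by (intro continuous_intros y(1))
    moreover have "g (z t) = x t" if "t \<in> {0..1}" for t
      using a(1)[of 0] a(1)[of 1] y(3)[OF that] by (simp add: z_def g.diff g.add g.scaleR)
    moreover have "norm (z t) \<le> 3 * M * r" if t: "t \<in> {0..1}" for t
    proof -
      have "norm ((1 - t) *\<^sub>R a 0) \<le> 1 * (M * r)" "norm (t *\<^sub>R a 1) \<le> 1 * (M * r)"
        using t a(2)[of 0] a(2)[of 1] M(1) \<open>r > 0\<close>
        unfolding norm_scaleR by (intro mult_mono; simp)+
      then show ?thesis
        using y(2)[OF t] norm_triangle_ineq4[of "y t" "(1 - t) *\<^sub>R a 0 + t *\<^sub>R a 1"]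
          norm_triangle_ineq[of "(1 - t) *\<^sub>R a 0" "t *\<^sub>R a 1"]
        by (simp add: z_def)
    qed
    moreover have "\<forall>t\<in>{0,1}. x t = 0 \<longrightarrow> z t = 0"
      by (auto simp: z_def a_def)
    ultimately show "\<exists>y. continuous_on {0..1} y \<and>
        (\<forall>t\<in>{0..1}. norm (y t) \<le> 3 * M * r \<and> g (y t) = x t) \<and> (\<forall>t\<in>{0,1}. x t = 0 \<longrightarrow> y t = 0)"
      by blast
  qed
qed


section \<open>Matrices over a closed unital subalgebra\<close>

text \<open>A common setting for whole types and for the pullback, which is only a subset of a
  type.\<close>

locale closed_subalgebra =
  fixes A :: "'a::unital_cstar_algebra set"
  assumes closed: "closed A" and zero: "0 \<in> A" and one: "1 \<in> A"
    and add: "x \<in> A \<Longrightarrow> y \<in> A \<Longrightarrow> x + y \<in> A"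
    and mult: "x \<in> A \<Longrightarrow> y \<in> A \<Longrightarrow> x * y \<in> A"
    and scaleR: "x \<in> A \<Longrightarrow> r *\<^sub>R x \<in> A"
begin

lemma minus: "x \<in> A \<Longrightarrow> - x \<in> A"
  using scaleR[of x "-1"] by simp

lemma diff: "x \<in> A \<Longrightarrow> y \<in> A \<Longrightarrow> x - y \<in> A"
  using add[of x "- y"] minus[of y] by simp

lemma sum: "(\<And>i. i \<in> I \<Longrightarrow> f i \<in> A) \<Longrightarrow> sum f I \<in> A"
  by (induction I rule: infinite_finite_induct) (auto simp: zero add)

end

interpretation UNIV_subalgebra: closed_subalgebra UNIV
  by unfold_locales auto

lemma mat_mult_apply:
  "i < m \<Longrightarrow> j < m \<Longrightarrow> mat_mult m a b (i, j) = (\<Sum>k<m. a (i, k) * b (k, j))"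
  by (simp add: mat_mult_def)

lemma mat_one_apply: "i < m \<Longrightarrow> j < m \<Longrightarrow> mat_one m (i, j) = (if i = j then 1 else 0)"
  by (simp add: mat_one_def)

lemma mat_mult_extensional [simp]: "mat_mult m a b \<in> extensional (idx m)"
  by (simp add: mat_mult_def)

lemma mat_one_extensional [simp]: "mat_one m \<in> extensional (idx m)"
  by (simp add: mat_one_def)

lemma mat_eqI:
  assumes "a \<in> extensional (idx m)" "b \<in> extensional (idx m)"
    and "\<And>i j. i < m \<Longrightarrow> j < m \<Longrightarrow> a (i, j) = b (i, j)"
  shows "a = b"
  using assms by (intro extensionalityI[of a "idx m" b]) auto

lemma mat_mult_cong:
  assumes "\<And>i j. i < m \<Longrightarrow> j < m \<Longrightarrow> a (i, j) = a' (i, j)"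
    and "\<And>i j. i < m \<Longrightarrow> j < m \<Longrightarrow> b (i, j) = b' (i, j)"
  shows "mat_mult m a b = mat_mult m a' b'"
proof (rule mat_eqI)
  fix i j assume "i < m" "j < m"
  then show "mat_mult m a b (i, j) = mat_mult m a' b' (i, j)"
    using assms by (simp add: mat_mult_apply)
qed auto

lemma mat_mult_assoc: "mat_mult m (mat_mult m a b) c = mat_mult m a (mat_mult m b c)"
proof (rule mat_eqI)
  fix i j assume ij: "i < m" "j < m"
  have "mat_mult m (mat_mult m a b) c (i, j) = (\<Sum>k<m. \<Sum>l<m. a (i, l) * b (l, k) * c (k, j))"
    using ij by (simp add: mat_mult_apply sum_distrib_right)
  also have "\<dots> = (\<Sum>l<m. \<Sum>k<m. a (i, l) * b (l, k) * c (k, j))"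
    by (rule sum.swap)
  also have "\<dots> = mat_mult m a (mat_mult m b c) (i, j)"
    using ij by (simp add: mat_mult_apply sum_distrib_left mult.assoc)
  finally show "mat_mult m (mat_mult m a b) c (i, j) = mat_mult m a (mat_mult m b c) (i, j)" .
qed auto

lemma mat_mult_one_left:
  assumes "a \<in> extensional (idx m)"
  shows "mat_mult m (mat_one m) a = a"
proof (rule mat_eqI)
  fix i j assume "i < m" "j < m"
  then show "mat_mult m (mat_one m) a (i, j) = a (i, j)"
    by (simp add: mat_mult_apply mat_one_apply if_distrib[of "\<lambda>x. x * _"] cong: if_cong)
qed (use assms in auto)

lemma mat_mult_one_right:
  assumes "a \<in> extensional (idx m)"
  shows "mat_mult m a (mat_one m) = a"
proof (rule mat_eqI)
  fix i j assume "i < m" "j < m"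
  then show "mat_mult m a (mat_one m) (i, j) = a (i, j)"
    by (simp add: mat_mult_apply mat_one_apply if_distrib[of "\<lambda>x. _ * x"] cong: if_cong)
qed (use assms in auto)

lemma mat_mult_diff_left:
  assumes "p \<in> idx m"
  shows "mat_mult m (\<lambda>q. a q - b q) c p = mat_mult m a c p - mat_mult m b c p"
  using assms by (auto simp: mat_mult_apply left_diff_distrib sum_subtractf)

lemma mat_mult_diff_right:
  assumes "p \<in> idx m"
  shows "mat_mult m c (\<lambda>q. a q - b q) p = mat_mult m c a p - mat_mult m c b p"
  using assms by (auto simp: mat_mult_apply right_diff_distrib sum_subtractf)

lemma topspace_Mat_top: "topspace (Mat_top m A) = idx m \<rightarrow>\<^sub>E A"
  by (simp add: Mat_top_def)

lemma (in closed_subalgebra) mat_mult_closed: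
  "a \<in> idx m \<rightarrow>\<^sub>E A \<Longrightarrow> b \<in> idx m \<rightarrow>\<^sub>E A \<Longrightarrow> mat_mult m a b \<in> idx m \<rightarrow>\<^sub>E A"
  by (intro PiE_I) (auto simp: mat_mult_def intro!: sum mult)

lemma (in closed_subalgebra) mat_one_closed: "mat_one m \<in> idx m \<rightarrow>\<^sub>E A"
  by (intro PiE_I) (auto simp: mat_one_def zero one)

lemma PiE_extensional: "a \<in> I \<rightarrow>\<^sub>E A \<Longrightarrow> a \<in> extensional I"
  by (simp add: PiE_def)


section \<open>The matrix norm and the Neumann series\<close>

text \<open>The entrywise sum replaces the operator norm: it is visibly continuous for the product
  topology and still submultiplicative, as the Neumann series requires. It is not normalized: the
  identity may have norm other than 1.\<close>

definition mnorm :: "nat \<Rightarrow> (nat \<times> nat \<Rightarrow> 'a::real_normed_vector) \<Rightarrow> real" where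
  "mnorm m a = (\<Sum>p\<in>idx m. norm (a p))"

lemma mnorm_nonneg [simp]: "0 \<le> mnorm m a"
  by (simp add: mnorm_def sum_nonneg)

lemma norm_le_mnorm: "p \<in> idx m \<Longrightarrow> norm (a p) \<le> mnorm m a"
  unfolding mnorm_def by (rule member_le_sum) auto

lemma mnorm_cong: "(\<And>p. p \<in> idx m \<Longrightarrow> a p = b p) \<Longrightarrow> mnorm m a = mnorm m b"
  unfolding mnorm_def by (intro sum.cong) auto

lemma mnorm_add_le: "mnorm m (\<lambda>p. a p + b p) \<le> mnorm m a + mnorm m b"
  by (simp add: mnorm_def flip: sum.distrib) (intro sum_mono norm_triangle_ineq)

lemma mnorm_minus_commute: "mnorm m (\<lambda>p. a p - b p) = mnorm m (\<lambda>p. b p - a p)"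
  by (simp add: mnorm_def norm_minus_commute)

lemma mnorm_scaleR: "mnorm m (\<lambda>p. r *\<^sub>R a p) = \<bar>r\<bar> * mnorm m a"
  by (simp add: mnorm_def sum_distrib_left)

lemma mnorm_mat_mult_le: "mnorm m (mat_mult m a b) \<le> mnorm m a * mnorm m b"
proof -
  have "mnorm m (mat_mult m a b) = (\<Sum>i<m. \<Sum>j<m. norm (\<Sum>k<m. a (i, k) * b (k, j)))"
    by (simp add: mnorm_def sum.cartesian_product' mat_mult_apply)
  also have "\<dots> \<le> (\<Sum>i<m. \<Sum>j<m. \<Sum>k<m. norm (a (i, k)) * norm (b (k, j)))"
    by (intro sum_mono order_trans[OF norm_sum]) (simp add: norm_mult_ineq)
  also have "\<dots> = (\<Sum>i<m. \<Sum>k<m. norm (a (i, k)) * (\<Sum>j<m. norm (b (k, j))))"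
    by (simp add: sum_distrib_left) (intro sum.cong refl sum.swap)
  also have "\<dots> \<le> (\<Sum>i<m. \<Sum>k<m. norm (a (i, k)) * mnorm m b)"
  proof (intro sum_mono mult_left_mono)
    fix k assume "k \<in> {..<m}"
    then show "(\<Sum>j<m. norm (b (k, j))) \<le> mnorm m b"
      unfolding mnorm_def sum.cartesian_product'
      by (intro member_le_sum[of k "{..<m}" "\<lambda>k. \<Sum>j<m. norm (b (k, j))"]) (auto intro: sum_nonneg)
  qed auto
  also have "\<dots> = mnorm m a * mnorm m b"
    unfolding mnorm_def[of m a] by (simp add: sum.cartesian_product' sum_distrib_right)
  finally show ?thesis .
qed

lemma GL_iff:
  "g \<in> GL m A \<longleftrightarrow> g \<in> idx m \<rightarrow>\<^sub>E A \<and>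
    (\<exists>b\<in>idx m \<rightarrow>\<^sub>E A. mat_mult m g b = mat_one m \<and> mat_mult m b g = mat_one m)"
  by (simp add: GL_def topspace_Mat_top)

lemma GL_extensional: "g \<in> GL m A \<Longrightarrow> g \<in> extensional (idx m)"
  by (auto simp: GL_iff PiE_extensional)

lemma GL_PiE: "g \<in> GL m A \<Longrightarrow> g \<in> idx m \<rightarrow>\<^sub>E A"
  by (simp add: GL_iff)

context closed_subalgebra begin

text \<open>The inverse is the sum of the powers of 1 - \<open>g\<close>, formed entry by entry.
  Partial sums have entries in \<open>A\<close>, and so have their limits because \<open>A\<close>
  is closed.\<close>

lemma Neumann:
  assumes g: "g \<in> idx m \<rightarrow>\<^sub>E A" and small: "mnorm m (\<lambda>p. g p - mat_one m p) < 1"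
  shows "g \<in> GL m A"
proof -
  define y where "y = (\<lambda>p\<in>idx m. mat_one m p - g p)"
  have yA: "y \<in> idx m \<rightarrow>\<^sub>E A"
    using g mat_one_closed[of m] by (auto simp: y_def PiE_iff intro: diff)
  define r where "r = mnorm m y"
  have r: "0 \<le> r" "r < 1"
  proof -
    have "mnorm m y = mnorm m (\<lambda>p. g p - mat_one m p)"
      by (subst mnorm_minus_commute) (auto simp: y_def intro: mnorm_cong)
    then show "r < 1" using small by (simp add: r_def)
  qed (simp add: r_def)
  define Y where "Y n = (mat_mult m y ^^ n) (mat_one m)" for n
  have Y0: "Y 0 = mat_one m" and YS: "Y (Suc n) = mat_mult m y (Y n)" for n
    by (simp_all add: Y_def)
  have YA: "Y n \<in> idx m \<rightarrow>\<^sub>E A" for n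
    by (induction n) (auto simp: Y0 YS mat_one_closed mat_mult_closed yA)
  \<comment> \<open>\<open>Y\<close> is built by multiplication from the left; to see that the
    series is also a left inverse, multiplication from the right must give the same powers.\<close>
  have comm: "mat_mult m (Y n) y = Y (Suc n)" for n
  proof (induction n)
    case 0
    then show ?case using yA by (simp add: Y0 YS mat_mult_one_left mat_mult_one_right PiE_extensional)
  next
    case (Suc n)
    have "mat_mult m (Y (Suc n)) y = mat_mult m y (mat_mult m (Y n) y)"
      by (simp add: YS mat_mult_assoc)
    then show ?case using Suc by (simp add: YS)
  qed
  have Ynorm: "mnorm m (Y n) \<le> mnorm m (mat_one m :: nat \<times> nat \<Rightarrow> 'a) * r ^ n" for n
  proof (induction n)
    case (Suc n)
    have "mnorm m (Y (Suc n)) \<le> r * mnorm m (Y n)"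
      unfolding YS r_def by (rule mnorm_mat_mult_le)
    also have "\<dots> \<le> r * (mnorm m (mat_one m :: nat \<times> nat \<Rightarrow> 'a) * r ^ n)"
      by (intro mult_left_mono Suc r)
    finally show ?case by (simp add: mult_ac)
  qed (simp add: Y0)
  have bound: "norm (Y n p) \<le> mnorm m (mat_one m :: nat \<times> nat \<Rightarrow> 'a) * r ^ n" if "p \<in> idx m" for n p
    using norm_le_mnorm[OF that, of "Y n"] Ynorm[of n] by linarith
  have sm: "summable (\<lambda>n. Y n p)" if "p \<in> idx m" for p
    by (rule summable_comparison_test'[where g="\<lambda>n. mnorm m (mat_one m :: nat \<times> nat \<Rightarrow> 'a) * r ^ n"])
      (use bound[OF that] r in \<open>auto intro!: summable_mult summable_geometric\<close>)
  define b where "b = (\<lambda>p\<in>idx m. \<Sum>n. Y n p)"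
  have "(\<Sum>n. Y n p) \<in> A" if "p \<in> idx m" for p
  proof (rule closed_sequentially[OF closed _ summable_LIMSEQ[OF sm[OF that]]])
    show "(\<Sum>i<n. Y i p) \<in> A" for n
      using YA that by (intro sum) (auto simp: PiE_iff)
  qed
  then have bA: "b \<in> idx m \<rightarrow>\<^sub>E A" by (simp add: b_def)
  have lim0: "(\<lambda>n. Y n p) \<longlonglongrightarrow> 0" if "p \<in> idx m" for p
    by (rule summable_LIMSEQ_zero[OF sm[OF that]])
  have b_sums: "(\<lambda>n. Y n p) sums b p" if "p \<in> idx m" for p
    using sm[OF that] that by (simp add: b_def summable_sums)
  have gy: "g p = mat_one m p - y p" if "p \<in> idx m" for p
    using that by (simp add: y_def)
  have gY: "mat_mult m g (Y n) p = Y n p - Y (Suc n) p" if "p \<in> idx m" for n p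
  proof -
    have "mat_mult m g (Y n) = mat_mult m (\<lambda>p. mat_one m p - y p) (Y n)"
      by (rule mat_mult_cong) (auto simp: gy)
    then show ?thesis
      using that YA[of n] by (simp add: mat_mult_diff_left mat_mult_one_left YS PiE_extensional)
  qed
  have Yg: "mat_mult m (Y n) g p = Y n p - Y (Suc n) p" if "p \<in> idx m" for n p
  proof -
    have "mat_mult m (Y n) g = mat_mult m (Y n) (\<lambda>p. mat_one m p - y p)"
      by (rule mat_mult_cong) (auto simp: gy)
    then show ?thesis
      using that YA[of n] by (simp add: mat_mult_diff_right mat_mult_one_right comm PiE_extensional)
  qed
  have tele: "(\<lambda>n. Y n p - Y (Suc n) p) sums mat_one m p" if "p \<in> idx m" for p
    using telescope_sums'[OF lim0[OF that]] by (simp add: Y0)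
  have "mat_mult m g b = mat_one m"
  proof (rule mat_eqI)
    fix i j assume ij: "i < m" "j < m"
    have "(\<lambda>n. mat_mult m g (Y n) (i, j)) sums mat_mult m g b (i, j)"
      unfolding mat_mult_apply[OF ij] by (intro sums_sum sums_mult b_sums) (use ij in auto)
    moreover have "(\<lambda>n. mat_mult m g (Y n) (i, j)) sums mat_one m (i, j)"
      using tele[of "(i, j)"] gY[of "(i, j)"] ij by simp
    ultimately show "mat_mult m g b (i, j) = mat_one m (i, j)" by (rule sums_unique2)
  qed auto
  moreover have "mat_mult m b g = mat_one m"
  proof (rule mat_eqI)
    fix i j assume ij: "i < m" "j < m"
    have "(\<lambda>n. mat_mult m (Y n) g (i, j)) sums mat_mult m b g (i, j)"
      unfolding mat_mult_apply[OF ij] by (intro sums_sum sums_mult2 b_sums) (use ij in auto)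
    moreover have "(\<lambda>n. mat_mult m (Y n) g (i, j)) sums mat_one m (i, j)"
      using tele[of "(i, j)"] Yg[of "(i, j)"] ij by simp
    ultimately show "mat_mult m b g (i, j) = mat_one m (i, j)" by (rule sums_unique2)
  qed auto
  ultimately show ?thesis using g bA by (auto simp: GL_iff)
qed

end


section \<open>Inverse matrices\<close>

text \<open>No subalgebra appears here: an inverse is unique among the ambient matrices, so one
  operation serves all \<open>A\<close>, and membership in \<open>GL m A\<close> is recovered from
  the inverse that \<open>GL\<close> provides.\<close>

definition minv :: "nat \<Rightarrow> (nat \<times> nat \<Rightarrow> 'a::unital_cstar_algebra) \<Rightarrow> nat \<times> nat \<Rightarrow> 'a" where
  "minv m g = (THE b. b \<in> extensional (idx m) \<and> mat_mult m g b = mat_one m \<and>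
     mat_mult m b g = mat_one m)"

lemma minv_eqI:
  assumes "b \<in> extensional (idx m)" "mat_mult m g b = mat_one m" "mat_mult m b g = mat_one m"
  shows "minv m g = b"
  unfolding minv_def
proof (rule the_equality)
  fix b' assume b': "b' \<in> extensional (idx m) \<and> mat_mult m g b' = mat_one m \<and>
     mat_mult m b' g = mat_one m"
  then have "mat_mult m (mat_mult m b g) b' = mat_mult m b (mat_mult m g b')"
    by (simp add: mat_mult_assoc)
  then show "b' = b" using assms b' by (simp add: mat_mult_one_left mat_mult_one_right)
qed (use assms in auto)

lemma minv:
  assumes "g \<in> GL m A"
  shows "mat_mult m g (minv m g) = mat_one m" "mat_mult m (minv m g) g = mat_one m"
    "minv m g \<in> GL m A"
proof -
  obtain b where b: "b \<in> idx m \<rightarrow>\<^sub>E A" "mat_mult m g b = mat_one m" "mat_mult m b g = mat_one m"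
    using assms by (auto simp: GL_iff)
  then have "minv m g = b" by (intro minv_eqI) (auto simp: PiE_extensional)
  then show "mat_mult m g (minv m g) = mat_one m" "mat_mult m (minv m g) g = mat_one m"
    "minv m g \<in> GL m A"
    using b assms by (auto simp: GL_iff)
qed

lemma (in closed_subalgebra) GL_mult:
  assumes "g \<in> GL m A" "h \<in> GL m A"
  shows "mat_mult m g h \<in> GL m A"
    and "minv m (mat_mult m g h) = mat_mult m (minv m h) (minv m g)"
proof -
  have 1: "mat_mult m (mat_mult m g h) (mat_mult m (minv m h) (minv m g))
      = mat_mult m g (mat_mult m (mat_mult m h (minv m h)) (minv m g))"
    by (simp add: mat_mult_assoc)
  have 2: "mat_mult m (mat_mult m (minv m h) (minv m g)) (mat_mult m g h)
      = mat_mult m (minv m h) (mat_mult m (mat_mult m (minv m g) g) h)"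
    by (simp add: mat_mult_assoc)
  have inv: "mat_mult m (mat_mult m g h) (mat_mult m (minv m h) (minv m g)) = mat_one m"
    "mat_mult m (mat_mult m (minv m h) (minv m g)) (mat_mult m g h) = mat_one m"
    unfolding 1 2 using assms
    by (simp_all add: minv mat_mult_one_left GL_extensional GL_extensional[OF minv(3)])
  show "minv m (mat_mult m g h) = mat_mult m (minv m h) (minv m g)"
    by (rule minv_eqI) (use inv in auto)
  have "mat_mult m (minv m h) (minv m g) \<in> idx m \<rightarrow>\<^sub>E A" "mat_mult m g h \<in> idx m \<rightarrow>\<^sub>E A"
    using assms by (simp_all add: mat_mult_closed GL_PiE minv(3))
  then show "mat_mult m g h \<in> GL m A" using inv by (auto simp: GL_iff)
qed

lemma (in closed_subalgebra) GL_one: "mat_one m \<in> GL m A"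
  using mat_one_closed[of m] by (auto simp: GL_iff mat_mult_one_left intro!: bexI[of _ "mat_one m"])

lemma minv_one: "minv m (mat_one m) = mat_one m"
  by (rule minv_eqI) (auto simp: mat_mult_one_left)

lemma minv_mult_cancel_left:
  assumes "g \<in> GL m A" "x \<in> extensional (idx m)"
  shows "mat_mult m (minv m g) (mat_mult m g x) = x" "mat_mult m g (mat_mult m (minv m g) x) = x"
  using minv[OF assms(1)] assms(2) by (simp_all flip: mat_mult_assoc add: mat_mult_one_left)

lemma minv_mult_cancel_right:
  assumes "g \<in> GL m A" "x \<in> extensional (idx m)"
  shows "mat_mult m (mat_mult m x g) (minv m g) = x" "mat_mult m (mat_mult m x (minv m g)) g = x"
  using minv[OF assms(1)] assms(2) by (simp_all add: mat_mult_assoc mat_mult_one_right)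

text \<open>The resolvent identity; it turns continuity of inversion into an estimate on the
  difference of \<open>h\<close> and \<open>g\<close>.\<close>

lemma minv_diff:
  assumes "g \<in> GL m A" "h \<in> GL m A" "p \<in> idx m"
  shows "minv m g p - minv m h p = mat_mult m (minv m g) (mat_mult m (\<lambda>q. h q - g q) (minv m h)) p"
proof -
  have ext: "minv m g \<in> extensional (idx m)" "minv m h \<in> extensional (idx m)"
    using assms minv(3) GL_extensional by blast+
  have "mat_mult m (minv m g) (mat_mult m (\<lambda>q. h q - g q) (minv m h)) =
      mat_mult m (minv m g) (\<lambda>q. mat_mult m h (minv m h) q - mat_mult m g (minv m h) q)"
    by (rule mat_mult_cong) (auto simp: mat_mult_diff_left)
  then show ?thesis
    using assms ext
    by (simp add: mat_mult_diff_right minv(1) mat_mult_one_right minv_mult_cancel_left)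
qed

text \<open>With the product in \<open>small\<close> at most 1/2, the resolvent identity bounds
  \<open>mnorm m (minv m g)\<close> by half of itself plus \<open>mnorm m (minv m h)\<close>, hence
  by twice the latter. Inserting this back leaves only the inverse of \<open>h\<close> in the
  bound.\<close>

lemma mnorm_minv_diff_le:
  assumes g: "g \<in> GL m A" and h: "h \<in> GL m A"
    and small: "mnorm m (\<lambda>q. g q - h q) * mnorm m (minv m h) \<le> 1 / 2"
  shows "mnorm m (\<lambda>q. minv m g q - minv m h q)
    \<le> 2 * mnorm m (minv m h) * (mnorm m (\<lambda>q. g q - h q) * mnorm m (minv m h))"
proof -
  let ?d = "mnorm m (\<lambda>q. g q - h q) * mnorm m (minv m h)"
  have "mnorm m (\<lambda>q. minv m g q - minv m h q) =
      mnorm m (mat_mult m (minv m g) (mat_mult m (\<lambda>q. h q - g q) (minv m h)))"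
    by (intro mnorm_cong minv_diff[OF g h])
  also have "\<dots> \<le> mnorm m (minv m g) * (mnorm m (\<lambda>q. h q - g q) * mnorm m (minv m h))"
    by (intro order_trans[OF mnorm_mat_mult_le] mult_left_mono mnorm_mat_mult_le) simp
  finally have le: "mnorm m (\<lambda>q. minv m g q - minv m h q) \<le> mnorm m (minv m g) * ?d"
    by (simp only: mnorm_minus_commute[of m h g])
  have "mnorm m (minv m g) \<le> mnorm m (\<lambda>q. minv m g q - minv m h q) + mnorm m (minv m h)"
    using mnorm_add_le[of m "\<lambda>q. minv m g q - minv m h q" "minv m h"] by simp
  also have "\<dots> \<le> mnorm m (minv m g) * (1 / 2) + mnorm m (minv m h)"
    using le mult_left_mono[OF small mnorm_nonneg[of m "minv m g"]] by linarith
  finally have "mnorm m (minv m g) \<le> 2 * mnorm m (minv m h)" by simp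
  then have "mnorm m (minv m g) * ?d \<le> 2 * mnorm m (minv m h) * ?d"
    by (intro mult_right_mono) auto
  then show ?thesis using le by linarith
qed

lemma tendsto_minv:
  assumes lim: "\<And>p. p \<in> idx m \<Longrightarrow> ((\<lambda>t. g t p) \<longlongrightarrow> h p) F"
    and g: "\<forall>\<^sub>F t in F. g t \<in> GL m A" and h: "h \<in> GL m A" and p: "p \<in> idx m"
  shows "((\<lambda>t. minv m (g t) p) \<longlongrightarrow> minv m h p) F"
proof -
  let ?d = "\<lambda>t. mnorm m (\<lambda>q. g t q - h q) * mnorm m (minv m h)"
  have "((\<lambda>t. mnorm m (\<lambda>q. g t q - h q)) \<longlongrightarrow> (\<Sum>q\<in>idx m. 0)) F"
    unfolding mnorm_def by (intro tendsto_sum tendsto_norm_zero LIM_zero lim)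
  then have d: "(?d \<longlongrightarrow> 0) F"
    by (intro tendsto_mult_left_zero) simp
  then have "\<forall>\<^sub>F t in F. ?d t < 1 / 2"
    by (rule order_tendstoD) simp
  with g have "\<forall>\<^sub>F t in F. norm (minv m (g t) p - minv m h p) \<le> 2 * mnorm m (minv m h) * ?d t"
  proof eventually_elim
    case (elim t)
    then have "mnorm m (\<lambda>q. minv m (g t) q - minv m h q) \<le> 2 * mnorm m (minv m h) * ?d t"
      by (intro mnorm_minv_diff_le[OF _ h]) auto
    then show ?case
      using norm_le_mnorm[OF p, of "\<lambda>q. minv m (g t) q - minv m h q"] by linarith
  qed
  then have "((\<lambda>t. minv m (g t) p - minv m h p) \<longlongrightarrow> 0) F"
    by (rule Lim_null_comparison) (intro tendsto_mult_right_zero d)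
  then show ?thesis by (rule LIM_zero_cancel)
qed


section \<open>Continuous families of invertible matrices\<close>

definition mat_continuous_on :: "'t::topological_space set \<Rightarrow> nat \<Rightarrow>
    ('t \<Rightarrow> nat \<times> nat \<Rightarrow> 'a::topological_space) \<Rightarrow> bool" where
  "mat_continuous_on S m p \<longleftrightarrow> (\<forall>q\<in>idx m. continuous_on S (\<lambda>t. p t q))"

definition mat_path :: "nat \<Rightarrow> 'a::unital_cstar_algebra set \<Rightarrow> (real \<Rightarrow> nat \<times> nat \<Rightarrow> 'a) \<Rightarrow> bool" where
  "mat_path m A p \<longleftrightarrow> mat_continuous_on {0..1} m p \<and> (\<forall>t\<in>{0..1}. p t \<in> GL m A)"

text \<open>Replaces the subspace of a product of subspaces by norm continuity of the entries, where
  the usual continuity rules apply.\<close>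

lemma continuous_map_into_GL_top:
  "continuous_map X (GL_top m A) p \<longleftrightarrow>
    (\<forall>t\<in>topspace X. p t \<in> GL m A) \<and> (\<forall>q\<in>idx m. continuous_map X euclidean (\<lambda>t. p t q))"
proof -
  have "p t \<in> extensional (idx m)" "p t q \<in> A" if "p t \<in> GL m A" "q \<in> idx m" for t q
    using GL_PiE[OF that(1)] that(2) by (auto simp: PiE_iff)
  moreover have "p t \<in> extensional (idx m)" if "p t \<in> GL m A" for t
    using that by (rule GL_extensional)
  ultimately show ?thesis
    unfolding GL_top_def Mat_top_def continuous_map_in_subtopology continuous_map_componentwise
    by (auto simp: Pi_iff image_subset_iff)
qed

lemma continuous_map_GL_top_iff:
  "continuous_map (top_of_set S) (GL_top m A) p \<longleftrightarrow>
    (\<forall>t\<in>S. p t \<in> GL m A) \<and> mat_continuous_on S m p"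
  by (simp add: continuous_map_into_GL_top mat_continuous_on_def)

lemma mat_path_iff: "mat_path m A p \<longleftrightarrow> continuous_map (top_of_set {0..1}) (GL_top m A) p"
  by (auto simp: mat_path_def continuous_map_GL_top_iff)

lemma topspace_GL_top [simp]: "topspace (GL_top m A) = GL m A"
  unfolding GL_top_def topspace_subtopology topspace_Mat_top using GL_PiE by blast

lemma mat_continuous_on_const: "mat_continuous_on S m (\<lambda>t. a)"
  by (simp add: mat_continuous_on_def)

lemma mat_continuous_on_mult:
  fixes p q :: "'t::topological_space \<Rightarrow> nat \<times> nat \<Rightarrow> 'a::unital_cstar_algebra"
  assumes "mat_continuous_on S m p" "mat_continuous_on S m q"
  shows "mat_continuous_on S m (\<lambda>t. mat_mult m (p t) (q t))"
  using assms
  by (auto simp: mat_continuous_on_def mat_mult_apply intro!: continuous_intros)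

lemma mat_continuous_on_minv:
  assumes p: "mat_continuous_on S m p" and GL: "\<And>t. t \<in> S \<Longrightarrow> p t \<in> GL m A"
  shows "mat_continuous_on S m (\<lambda>t. minv m (p t))"
  unfolding mat_continuous_on_def continuous_on_def
proof (intro ballI)
  fix q x assume "q \<in> idx m" "x \<in> S"
  then show "((\<lambda>t. minv m (p t) q) \<longlongrightarrow> minv m (p x) q) (at x within S)"
    using p GL
    by (intro tendsto_minv[where A=A])
      (auto simp: mat_continuous_on_def continuous_on_def eventually_at_filter)
qed

lemma mat_continuous_on_compose:
  assumes "mat_continuous_on S m p" "continuous_on T f" "f ` T \<subseteq> S"
  shows "mat_continuous_on T m (\<lambda>t. p (f t))"
  unfolding mat_continuous_on_def
proof
  fix q assume "q \<in> idx m"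
  then show "continuous_on T (\<lambda>t. p (f t) q)"
    using assms(1) unfolding mat_continuous_on_def
    by (intro continuous_on_compose2[OF _ assms(2,3), of "\<lambda>t. p t q"]) blast
qed

lemma continuous_on_mnorm_diff:
  assumes "mat_continuous_on S m p" "mat_continuous_on S m (q :: 't::topological_space \<Rightarrow> _ \<Rightarrow> 'a::real_normed_vector)"
  shows "continuous_on S (\<lambda>t. mnorm m (\<lambda>i. p t i - q t i))"
  using assms unfolding mnorm_def mat_continuous_on_def by (auto intro!: continuous_intros)

lemma mat_path_const: "g \<in> GL m A \<Longrightarrow> mat_path m A (\<lambda>t. g)"
  by (simp add: mat_path_def mat_continuous_on_const)

lemma mat_path_minv: "mat_path m A p \<Longrightarrow> mat_path m A (\<lambda>t. minv m (p t))"
  by (auto simp: mat_path_def minv(3) intro: mat_continuous_on_minv)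

context closed_subalgebra begin

lemma mat_path_mult:
  "mat_path m A p \<Longrightarrow> mat_path m A q \<Longrightarrow> mat_path m A (\<lambda>t. mat_mult m (p t) (q t))"
  by (auto simp: mat_path_def GL_mult(1) intro: mat_continuous_on_mult)

text \<open>Every point of the segment from the identity to \<open>u\<close> is at least as close to
  the identity as \<open>u\<close>, so the Neumann series makes it invertible.\<close>

lemma Neumann_path:
  assumes u: "u \<in> idx m \<rightarrow>\<^sub>E A" and small: "mnorm m (\<lambda>p. u p - mat_one m p) < 1"
  obtains s where "mat_path m A s" "s 0 = mat_one m" "s 1 = u"
proof
  let ?s = "\<lambda>t. \<lambda>q\<in>idx m. mat_one m q + t *\<^sub>R (u q - mat_one m q)"
  show "?s 0 = mat_one m" "?s 1 = u"
    using u by (auto simp: PiE_def intro!: extensionalityI[of _ "idx m"])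
  have "?s t \<in> GL m A" if t: "t \<in> {0..1}" for t :: real
  proof (rule Neumann)
    show "?s t \<in> idx m \<rightarrow>\<^sub>E A"
      using u mat_one_closed[of m] by (auto simp: PiE_iff intro!: add scaleR diff)
    have "mnorm m (\<lambda>p. ?s t p - mat_one m p) = mnorm m (\<lambda>p. t *\<^sub>R (u p - mat_one m p))"
      by (rule mnorm_cong) auto
    also have "\<dots> \<le> 1 * mnorm m (\<lambda>p. u p - mat_one m p)"
      unfolding mnorm_scaleR using t by (intro mult_right_mono) auto
    finally show "mnorm m (\<lambda>p. ?s t p - mat_one m p) < 1" using small by simp
  qed
  then show "mat_path m A ?s"
    by (auto simp: mat_path_def mat_continuous_on_def intro!: continuous_intros)
qed

text \<open>The set of path-reachable elements and its complement are both open, because an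
  element near \<open>g\<close> is the product of \<open>g\<close> with an element of norm distance less than 1 from
  the identity.\<close>

lemma GL0_iff_path:
  "g \<in> GL0 m A \<longleftrightarrow> (\<exists>p. mat_path m A p \<and> p 0 = mat_one m \<and> p 1 = g)"
proof
  assume "\<exists>p. mat_path m A p \<and> p 0 = mat_one m \<and> p 1 = g"
  then obtain p where p: "mat_path m A p" "p 0 = mat_one m" "p 1 = g" by blast
  have "connectedin (GL_top m A) (p ` {0..1})"
    by (rule connectedin_continuous_map_image[OF p(1)[unfolded mat_path_iff]])
      (simp add: connectedin_subtopology)
  moreover have "mat_one m \<in> p ` {0..1}" "g \<in> p ` {0..1}"
    using p(2,3) by (force intro: image_eqI[of _ p 0] image_eqI[of _ p 1])+
  ultimately show "g \<in> GL0 m A"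
    unfolding GL0_def connected_component_of_def by blast
next
  define P where "P = {h. \<exists>p. mat_path m A p \<and> p 0 = mat_one m \<and> p 1 = h}"
  \<comment> \<open>For invertible \<open>g\<close> and \<open>h\<close> in this set,
    \<open>h\<close> times the inverse of \<open>g\<close> is within 1 of the identity.\<close>
  define U where "U g = {h \<in> topspace (GL_top m A). mnorm m (\<lambda>q. h q - g q) * mnorm m (minv m g) \<in> {..<1}}"
    for g
  have openU: "openin (GL_top m A) (U g)" for g
    unfolding U_def
  proof (rule openin_continuous_map_preimage)
    have "continuous_map (GL_top m A) euclidean (\<lambda>h. h q)" if "q \<in> idx m" for q
      using continuous_map_id[of "GL_top m A"] that unfolding continuous_map_into_GL_top id_apply by blast
    then show "continuous_map (GL_top m A) euclidean
        (\<lambda>h. mnorm m (\<lambda>q. h q - g q) * mnorm m (minv m g))"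
      unfolding mnorm_def
      by (intro continuous_map_real_mult continuous_map_sum continuous_map_norm
          continuous_map_diff continuous_map_const[THEN iffD2]) auto
    show "openin euclidean {..<1::real}" by simp
  qed
  \<comment> \<open>Both implications matter: one opens \<open>P\<close>, the other its
    complement.\<close>
  have same: "h \<in> P \<longleftrightarrow> g \<in> P" if g: "g \<in> GL m A" and h: "h \<in> U g" for g h
  proof -
    have hGL: "h \<in> GL m A" and small: "mnorm m (\<lambda>q. h q - g q) * mnorm m (minv m g) < 1"
      using h by (auto simp: U_def)
    let ?u = "mat_mult m h (minv m g)"
    have "mnorm m (\<lambda>p. ?u p - mat_one m p) = mnorm m (mat_mult m (\<lambda>q. h q - g q) (minv m g))"
      by (rule mnorm_cong) (simp add: mat_mult_diff_left minv(1)[OF g])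
    then have "mnorm m (\<lambda>p. ?u p - mat_one m p) < 1"
      using mnorm_mat_mult_le[of m "\<lambda>q. h q - g q" "minv m g"] small by linarith
    moreover have u: "?u \<in> GL m A" by (intro GL_mult hGL minv(3) g)
    ultimately obtain s where s: "mat_path m A s" "s 0 = mat_one m" "s 1 = ?u"
      using Neumann_path[OF GL_PiE] by blast
    have ug: "mat_mult m ?u g = h"
      by (rule minv_mult_cancel_right(2)[OF g GL_extensional[OF hGL]])
    show ?thesis
    proof
      assume "g \<in> P"
      then obtain p where p: "mat_path m A p" "p 0 = mat_one m" "p 1 = g" by (auto simp: P_def)
      show "h \<in> P" unfolding P_def
        using mat_path_mult[OF s(1) p(1)] s p ug
        by (auto intro!: exI[of _ "\<lambda>t. mat_mult m (s t) (p t)"] simp: mat_mult_one_left)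
    next
      assume "h \<in> P"
      then obtain p where p: "mat_path m A p" "p 0 = mat_one m" "p 1 = h" by (auto simp: P_def)
      have "mat_mult m (minv m ?u) h = g"
        using minv_mult_cancel_left(1)[OF u GL_extensional[OF g]] ug by simp
      then show "g \<in> P" unfolding P_def
        using mat_path_mult[OF mat_path_minv[OF s(1)] p(1)] s p
        by (auto intro!: exI[of _ "\<lambda>t. mat_mult m (minv m (s t)) (p t)"]
            simp: mat_mult_one_left minv_one)
    qed
  qed
  have self: "g \<in> U g" if "g \<in> GL m A" for g
    using that by (simp add: U_def mnorm_def)
  have PGL: "P \<subseteq> GL m A" by (auto simp: P_def mat_path_def)
  have open_sat: "openin (GL_top m A) V" if "V \<subseteq> GL m A" "\<And>g h. g \<in> V \<Longrightarrow> h \<in> U g \<Longrightarrow> h \<in> V" for V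
  proof (rule openin_subopen[THEN iffD2], rule ballI)
    fix x assume "x \<in> V"
    then show "\<exists>T. openin (GL_top m A) T \<and> x \<in> T \<and> T \<subseteq> V"
      using openU[of x] self[of x] that by (intro exI[of _ "U x"]) auto
  qed
  have "openin (GL_top m A) P" by (rule open_sat) (use same PGL in blast)+
  moreover have "openin (GL_top m A) (GL m A - P)"
    by (rule open_sat) (use same in \<open>auto simp: U_def\<close>)
  then have "closedin (GL_top m A) P" using PGL by (simp add: closedin_def)
  moreover assume "g \<in> GL0 m A"
  then obtain T where T: "connectedin (GL_top m A) T" "mat_one m \<in> T" "g \<in> T"
    by (auto simp: GL0_def connected_component_of_def)
  moreover have "mat_one m \<in> P"
    using mat_path_const[OF GL_one] by (auto simp: P_def)
  ultimately have "T \<subseteq> P"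
    using connectedin_clopen_cases[OF T(1)] T(2) by (auto simp: disjnt_iff)
  then show "\<exists>p. mat_path m A p \<and> p 0 = mat_one m \<and> p 1 = g"
    using T(3) by (auto simp: P_def)
qed

lemma GL0_subset_GL: "GL0 m A \<subseteq> GL m A"
  by (auto simp: GL0_iff_path mat_path_def)

lemma GL0_mult: "g \<in> GL0 m A \<Longrightarrow> h \<in> GL0 m A \<Longrightarrow> mat_mult m g h \<in> GL0 m A"
  unfolding GL0_iff_path
proof (elim exE conjE)
  fix p q assume "mat_path m A p" "mat_path m A q" "p 0 = mat_one m" "q 0 = mat_one m"
    "p 1 = g" "q 1 = h"
  then show "\<exists>r. mat_path m A r \<and> r 0 = mat_one m \<and> r 1 = mat_mult m g h"
    by (intro exI[of _ "\<lambda>t. mat_mult m (p t) (q t)"]) (simp add: mat_path_mult mat_mult_one_left)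
qed

lemma GL0_minv: "g \<in> GL0 m A \<Longrightarrow> minv m g \<in> GL0 m A"
  unfolding GL0_iff_path
proof (elim exE conjE)
  fix p assume "mat_path m A p" "p 0 = mat_one m" "p 1 = g"
  then show "\<exists>r. mat_path m A r \<and> r 0 = mat_one m \<and> r 1 = minv m g"
    by (intro exI[of _ "\<lambda>t. minv m (p t)"]) (simp add: mat_path_minv minv_one)
qed

end


section \<open>Homomorphisms on matrices\<close>

definition mmap :: "nat \<Rightarrow> ('a \<Rightarrow> 'b) \<Rightarrow> (nat \<times> nat \<Rightarrow> 'a) \<Rightarrow> nat \<times> nat \<Rightarrow> 'b" where
  "mmap m f a = (\<lambda>q\<in>idx m. f (a q))"

lemma mmap_apply: "q \<in> idx m \<Longrightarrow> mmap m f a q = f (a q)"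
  by (simp add: mmap_def)

lemma mmap_extensional [simp]: "mmap m f a \<in> extensional (idx m)"
  by (simp add: mmap_def)

text \<open>\<open>f\<close> is constrained only on \<open>A\<close>, so that the projections out of
  the pullback and the exchange of its factors fit the same scheme as \<delta> and \<gamma>.\<close>

locale subalgebra_hom = A: closed_subalgebra A + B: closed_subalgebra B
  for A :: "'a::unital_cstar_algebra set" and B :: "'b::unital_cstar_algebra set" +
  fixes f :: "'a \<Rightarrow> 'b"
  assumes maps: "x \<in> A \<Longrightarrow> f x \<in> B"
    and hom_add: "x \<in> A \<Longrightarrow> y \<in> A \<Longrightarrow> f (x + y) = f x + f y"
    and hom_mult: "x \<in> A \<Longrightarrow> y \<in> A \<Longrightarrow> f (x * y) = f x * f y"
    and hom_one: "f 1 = 1"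
    and cont: "continuous_on A f"
begin

lemma hom_zero: "f 0 = 0"
  using hom_add[OF A.zero A.zero] by simp

lemma hom_sum: "(\<And>i. i \<in> I \<Longrightarrow> g i \<in> A) \<Longrightarrow> f (sum g I) = (\<Sum>i\<in>I. f (g i))"
  by (induction I rule: infinite_finite_induct) (auto simp: hom_zero hom_add A.sum)

lemma mmap_PiE: "a \<in> idx m \<rightarrow>\<^sub>E A \<Longrightarrow> mmap m f a \<in> idx m \<rightarrow>\<^sub>E B"
  by (auto simp: mmap_def PiE_iff maps)

lemma mmap_mult:
  assumes "a \<in> idx m \<rightarrow>\<^sub>E A" "b \<in> idx m \<rightarrow>\<^sub>E A"
  shows "mmap m f (mat_mult m a b) = mat_mult m (mmap m f a) (mmap m f b)"
proof (rule mat_eqI)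
  fix i j assume "i < m" "j < m"
  then have aA: "a (i, k) \<in> A" and bA: "b (k, j) \<in> A" if "k < m" for k
    using assms that by (auto simp: PiE_iff)
  have "mmap m f (mat_mult m a b) (i, j) = f (\<Sum>k<m. a (i, k) * b (k, j))"
    using \<open>i < m\<close> \<open>j < m\<close> by (simp add: mmap_apply mat_mult_apply)
  also have "\<dots> = (\<Sum>k<m. f (a (i, k) * b (k, j)))"
    by (rule hom_sum) (simp add: aA bA A.mult)
  also have "\<dots> = mat_mult m (mmap m f a) (mmap m f b) (i, j)"
    using \<open>i < m\<close> \<open>j < m\<close> by (simp add: mmap_apply mat_mult_apply hom_mult aA bA)
  finally show "mmap m f (mat_mult m a b) (i, j) = mat_mult m (mmap m f a) (mmap m f b) (i, j)" .
qed auto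

lemma mmap_one: "mmap m f (mat_one m) = mat_one m"
  by (rule mat_eqI[of _ m]) (auto simp: mmap_apply mat_one_apply hom_one hom_zero)

lemma mmap_GL:
  assumes "g \<in> GL m A"
  shows "mmap m f g \<in> GL m B" "minv m (mmap m f g) = mmap m f (minv m g)"
proof -
  have g: "g \<in> idx m \<rightarrow>\<^sub>E A" and i: "minv m g \<in> idx m \<rightarrow>\<^sub>E A"
    using assms GL_PiE[OF minv(3)] by (simp_all add: GL_PiE)
  have "mat_mult m (mmap m f g) (mmap m f (minv m g)) = mat_one m"
    "mat_mult m (mmap m f (minv m g)) (mmap m f g) = mat_one m"
    using mmap_mult[OF g i] mmap_mult[OF i g] minv[OF assms] by (simp_all add: mmap_one)
  then show "mmap m f g \<in> GL m B" "minv m (mmap m f g) = mmap m f (minv m g)"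
    using mmap_PiE[OF g] mmap_PiE[OF i] by (auto simp: GL_iff intro: minv_eqI)
qed

lemma mat_continuous_on_mmap:
  assumes "mat_continuous_on S m p" "\<And>t. t \<in> S \<Longrightarrow> p t \<in> GL m A"
  shows "mat_continuous_on S m (\<lambda>t. mmap m f (p t))"
  unfolding mat_continuous_on_def
proof
  fix q assume q: "q \<in> idx m"
  have "continuous_on S (\<lambda>t. f (p t q))"
    by (rule continuous_on_compose2[OF cont])
      (use assms q in \<open>auto simp: mat_continuous_on_def PiE_iff dest!: GL_PiE\<close>)
  then show "continuous_on S (\<lambda>t. mmap m f (p t) q)" using q by (simp add: mmap_apply)
qed

lemma mat_path_mmap: "mat_path m A p \<Longrightarrow> mat_path m B (\<lambda>t. mmap m f (p t))"
  by (auto simp: mat_path_def mmap_GL intro: mat_continuous_on_mmap)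

lemma mmap_GL0: "g \<in> GL0 m A \<Longrightarrow> mmap m f g \<in> GL0 m B"
  unfolding A.GL0_iff_path B.GL0_iff_path
  by (elim exE conjE) (rule exI, rule conjI, erule mat_path_mmap, simp add: mmap_one)

end

lemma star_hom_subalgebra_hom:
  assumes "unital_star_hom f"
  shows "subalgebra_hom UNIV UNIV f"
  using star_homD[OF assms] bounded_linear_star_hom[OF assms]
  by unfold_locales (auto intro: linear_continuous_on)


section \<open>Lifting homotopies of invertible matrices\<close>

text \<open>Entries are lifted one at a time. The bound below 1 lets the Neumann series apply to the
  identity plus \<open>y\<close>, and the endpoint clause keeps a stationary endpoint
  stationary.\<close>

lemma matrix_path_lift:
  fixes f :: "'a::banach \<Rightarrow> 'b::banach"
  assumes f: "bounded_linear f" and surj: "surj f"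
  obtains e where "e > 0"
    "\<And>x :: real \<Rightarrow> nat \<times> nat \<Rightarrow> 'b. mat_continuous_on {0..1} m x \<Longrightarrow>
      (\<And>t. t \<in> {0..1} \<Longrightarrow> mnorm m (x t) \<le> e) \<Longrightarrow>
      \<exists>y. mat_continuous_on {0..1} m y \<and>
        (\<forall>t\<in>{0..1}. mnorm m (y t) < 1 \<and> (\<forall>q\<in>idx m. f (y t q) = x t q)) \<and>
        (\<forall>t\<in>{0,1}. \<forall>q\<in>idx m. x t q = 0 \<longrightarrow> y t q = 0)"
proof -
  obtain M where M: "M > 0" and lift: "\<And>(x :: real \<Rightarrow> 'b) r. continuous_on {0..1} x \<Longrightarrow> r > 0 \<Longrightarrow>
      (\<And>t. t \<in> {0..1} \<Longrightarrow> norm (x t) \<le> r) \<Longrightarrow>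
      \<exists>y. continuous_on {0..1} y \<and> (\<forall>t\<in>{0..1}. norm (y t) \<le> M * r \<and> f (y t) = x t) \<and>
        (\<forall>t\<in>{0,1}. x t = 0 \<longrightarrow> y t = 0)"
    using path_lift_rel_endpoints[OF f surj] by blast
  \<comment> \<open>Each of the \<open>m * m\<close> entries gets norm at most \<open>M * e\<close>;
    the extra 1 keeps their sum strictly below 1 and the denominator positive when \<open>m\<close>
    is 0.\<close>
  define e where "e = 1 / (M * real (m * m + 1))"
  have e: "e > 0" using M by (simp add: e_def add_pos_nonneg)
  show ?thesis
  proof (rule that[OF e])
    fix x :: "real \<Rightarrow> nat \<times> nat \<Rightarrow> 'b"
    assume x: "mat_continuous_on {0..1} m x" and le: "\<And>t. t \<in> {0..1} \<Longrightarrow> mnorm m (x t) \<le> e"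
    have "\<exists>y. continuous_on {0..1} y \<and> (\<forall>t\<in>{0..1}. norm (y t) \<le> M * e \<and> f (y t) = x t q) \<and>
        (\<forall>t\<in>{0,1}. x t q = 0 \<longrightarrow> y t = 0)" if "q \<in> idx m" for q
    proof (intro lift e)
      show "continuous_on {0..1} (\<lambda>t. x t q)"
        using x that unfolding mat_continuous_on_def by blast
      show "norm (x t q) \<le> e" if "t \<in> {0..1}" for t
        using le[OF that] norm_le_mnorm[OF \<open>q \<in> idx m\<close>, of "x t"] by linarith
    qed
    then have "\<exists>y. \<forall>q\<in>idx m. continuous_on {0..1} (y q) \<and>
        (\<forall>t\<in>{0..1}. norm (y q t) \<le> M * e \<and> f (y q t) = x t q) \<and>
        (\<forall>t\<in>{0,1}. x t q = 0 \<longrightarrow> y q t = 0)"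
      by (intro bchoice ballI)
    then obtain y where Y: "\<forall>q\<in>idx m. continuous_on {0..1} (y q) \<and>
        (\<forall>t\<in>{0..1}. norm (y q t) \<le> M * e \<and> f (y q t) = x t q) \<and>
        (\<forall>t\<in>{0,1}. x t q = 0 \<longrightarrow> y q t = 0)" ..
    have y: "continuous_on {0..1} (y q)" "t \<in> {0..1} \<Longrightarrow> norm (y q t) \<le> M * e"
      "t \<in> {0..1} \<Longrightarrow> f (y q t) = x t q" "t \<in> {0,1} \<Longrightarrow> x t q = 0 \<Longrightarrow> y q t = 0"
      if "q \<in> idx m" for q t
      using bspec[OF Y that] by auto
    have "mnorm m (\<lambda>q. y q t) < 1" if t: "t \<in> {0..1}" for t
    proof -
      have "mnorm m (\<lambda>q. y q t) \<le> (\<Sum>q\<in>idx m. M * e)"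
        unfolding mnorm_def by (intro sum_mono y(2) t)
      also have "\<dots> = real (m * m) / real (m * m + 1)"
        using M by (simp add: e_def)
      also have "\<dots> < 1" by (simp add: divide_less_eq add_pos_nonneg)
      finally show ?thesis .
    qed
    then show "\<exists>y. mat_continuous_on {0..1} m y \<and>
        (\<forall>t\<in>{0..1}. mnorm m (y t) < 1 \<and> (\<forall>q\<in>idx m. f (y t q) = x t q)) \<and>
        (\<forall>t\<in>{0,1}. \<forall>q\<in>idx m. x t q = 0 \<longrightarrow> y t q = 0)"
      using y by (intro exI[of _ "\<lambda>t q. y q t"]) (auto simp: mat_continuous_on_def)
  qed
qed

text \<open>Between two nearby stages of the homotopy the quotient is uniformly close to the
  identity, so it lifts; finitely many such steps suffice by uniform continuity.\<close>

lemma GL_homotopy_lift: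
  fixes f :: "'c::unital_cstar_algebra \<Rightarrow> 'd::unital_cstar_algebra"
    and H :: "real \<Rightarrow> real \<Rightarrow> nat \<times> nat \<Rightarrow> 'd"
  assumes f: "unital_star_hom f" and surj: "surj f"
    and H: "mat_continuous_on ({0..1} \<times> {0..1}) m (\<lambda>(s, t). H s t)"
    and GL: "\<And>s t. s \<in> {0..1} \<Longrightarrow> t \<in> {0..1} \<Longrightarrow> H s t \<in> GL m UNIV"
    and q0: "mat_path m UNIV q0" "\<And>t. t \<in> {0..1} \<Longrightarrow> mmap m f (q0 t) = H 0 t"
  obtains q1 :: "real \<Rightarrow> nat \<times> nat \<Rightarrow> 'c" where "mat_path m UNIV q1"
    "\<And>t. t \<in> {0..1} \<Longrightarrow> mmap m f (q1 t) = H 1 t"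
    "\<And>t. t \<in> {0,1} \<Longrightarrow> (\<And>s. s \<in> {0..1} \<Longrightarrow> H s t = H 0 t) \<Longrightarrow> q1 t = q0 t"
proof -
  interpret f: subalgebra_hom UNIV UNIV f by (rule star_hom_subalgebra_hom[OF f])
  obtain e where e: "e > 0" and lift: "\<And>x :: real \<Rightarrow> nat \<times> nat \<Rightarrow> 'd. mat_continuous_on {0..1} m x \<Longrightarrow>
      (\<And>t. t \<in> {0..1} \<Longrightarrow> mnorm m (x t) \<le> e) \<Longrightarrow>
      \<exists>y. mat_continuous_on {0..1} m y \<and>
        (\<forall>t\<in>{0..1}. mnorm m (y t) < 1 \<and> (\<forall>q\<in>idx m. f (y t q) = x t q)) \<and>
        (\<forall>t\<in>{0,1}. \<forall>q\<in>idx m. x t q = 0 \<longrightarrow> y t q = 0)"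
    using matrix_path_lift[OF bounded_linear_star_hom[OF f] surj, of m] by blast
  let ?I = "{0..1::real}"
  \<comment> \<open>Comparing all pairs of stages in one function on a compact cube yields a step
    size valid for every \<open>s\<close> and \<open>t\<close> at once.\<close>
  define F where "F = (\<lambda>(s', s, t). mat_mult m (H s' t) (minv m (H s t)))"
  have "continuous_on (?I \<times> ?I \<times> ?I) (\<lambda>x. (fst x, snd (snd x)))"
    "continuous_on (?I \<times> ?I \<times> ?I) snd"
    by (intro continuous_intros)+
  then have "mat_continuous_on (?I \<times> ?I \<times> ?I) m (\<lambda>x. H (fst x) (snd (snd x)))"
    "mat_continuous_on (?I \<times> ?I \<times> ?I) m (\<lambda>x. H (fst (snd x)) (snd (snd x)))"
    using mat_continuous_on_compose[OF H, of "?I \<times> ?I \<times> ?I" "\<lambda>x. (fst x, snd (snd x))"]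
      mat_continuous_on_compose[OF H, of "?I \<times> ?I \<times> ?I" "\<lambda>x. (fst (snd x), snd (snd x))"]
    by (simp_all add: split_def image_subset_iff)
  then have Fcont: "mat_continuous_on (?I \<times> ?I \<times> ?I) m F"
    unfolding F_def split_def
    by (intro mat_continuous_on_mult mat_continuous_on_minv[where A=UNIV] GL) auto
  define \<phi> where "\<phi> x = mnorm m (\<lambda>q. F x q - mat_one m q)" for x
  have "continuous_on (?I \<times> ?I \<times> ?I) \<phi>"
    unfolding \<phi>_def by (intro continuous_on_mnorm_diff Fcont mat_continuous_on_const)
  then have "uniformly_continuous_on (?I \<times> ?I \<times> ?I) \<phi>"
    by (rule compact_uniformly_continuous) (intro compact_Times compact_Icc)
  then obtain \<delta> where \<delta>: "\<delta> > 0" "\<And>x x'. x \<in> ?I \<times> ?I \<times> ?I \<Longrightarrow> x' \<in> ?I \<times> ?I \<times> ?I \<Longrightarrow>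
      dist x' x < \<delta> \<Longrightarrow> dist (\<phi> x') (\<phi> x) < e"
    using uniformly_continuous_onE[OF _ e] by blast
  \<comment> \<open>The last clause carries the endpoint control through the induction over the
    stages.\<close>
  define L where "L s q \<longleftrightarrow> mat_path m UNIV q \<and> (\<forall>t\<in>?I. mmap m f (q t) = H s t) \<and>
      (\<forall>t\<in>{0,1}. (\<forall>s\<in>?I. H s t = H 0 t) \<longrightarrow> q t = q0 t)" for s and q :: "real \<Rightarrow> nat \<times> nat \<Rightarrow> 'c"
  have step: "\<exists>q'. L s' q'" if s: "s \<in> ?I" "s' \<in> ?I" "\<bar>s' - s\<bar> < \<delta>" and q: "L s q" for s s' q
  proof -
    define x where "x t p = F (s', s, t) p - mat_one m p" for t p
    have xcont: "mat_continuous_on ?I m x"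
    proof -
      have "mat_continuous_on ?I m (\<lambda>t. F (s', s, t))"
        by (rule mat_continuous_on_compose[OF Fcont]) (use s in \<open>auto intro!: continuous_intros\<close>)
      then show ?thesis
        by (auto simp: mat_continuous_on_def x_def intro!: continuous_intros)
    qed
    have "mnorm m (x t) \<le> e" if t: "t \<in> ?I" for t
    proof -
      have "\<phi> (s, s, t) = 0"
        using minv(1)[OF GL[OF s(1) t]] by (simp add: \<phi>_def F_def mnorm_def)
      moreover have "dist (\<phi> (s', s, t)) (\<phi> (s, s, t)) < e"
        by (rule \<delta>(2)) (use s t in \<open>auto simp: dist_Pair_Pair dist_real_def\<close>)
      ultimately show ?thesis by (simp add: \<phi>_def x_def[abs_def])
    qed
    from lift[OF xcont this] obtain y where y: "mat_continuous_on ?I m y"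
      "\<And>t. t \<in> ?I \<Longrightarrow> mnorm m (y t) < 1" "\<And>t p. t \<in> ?I \<Longrightarrow> p \<in> idx m \<Longrightarrow> f (y t p) = x t p"
      "\<And>t p. t \<in> {0,1} \<Longrightarrow> p \<in> idx m \<Longrightarrow> x t p = 0 \<Longrightarrow> y t p = 0"
      by blast
    define u where "u t = (\<lambda>p\<in>idx m. mat_one m p + y t p)" for t
    have uGL: "u t \<in> GL m UNIV" if t: "t \<in> ?I" for t
    proof (rule UNIV_subalgebra.Neumann)
      have "mnorm m (\<lambda>p. u t p - mat_one m p) = mnorm m (y t)"
        by (rule mnorm_cong) (auto simp: u_def)
      then show "mnorm m (\<lambda>p. u t p - mat_one m p) < 1" using y(2)[OF t] by simp
    qed (auto simp: u_def)
    have upath: "mat_path m UNIV u"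
      using y(1) uGL
      by (auto simp: mat_path_def mat_continuous_on_def u_def intro!: continuous_intros)
    have fu: "mmap m f (u t) = mat_mult m (H s' t) (minv m (H s t))" if t: "t \<in> ?I" for t
    proof (rule mat_eqI)
      fix i j assume ij: "i < m" "j < m"
      then have "mmap m f (u t) (i, j) = mmap m f (mat_one m) (i, j) + x t (i, j)"
        using y(3)[OF t, of "(i, j)"] by (simp add: mmap_apply u_def f.hom_add)
      then show "mmap m f (u t) (i, j) = mat_mult m (H s' t) (minv m (H s t)) (i, j)"
        by (simp add: f.mmap_one x_def F_def)
    qed auto
    have qp: "mat_path m UNIV q" using q by (simp add: L_def)
    \<comment> \<open>Left multiplication by the lifted quotient carries a lift of stage
      \<open>s\<close> to a lift of stage \<open>s'\<close>.\<close>
    have "L s' (\<lambda>t. mat_mult m (u t) (q t))"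
      unfolding L_def
    proof (intro conjI ballI impI)
      show "mat_path m UNIV (\<lambda>t. mat_mult m (u t) (q t))"
        by (rule UNIV_subalgebra.mat_path_mult[OF upath qp])
      fix t assume t: "t \<in> ?I"
      have "mmap m f (mat_mult m (u t) (q t)) = mat_mult m (mmap m f (u t)) (mmap m f (q t))"
        using upath qp t by (intro f.mmap_mult GL_PiE) (auto simp: mat_path_def)
      also have "\<dots> = H s' t"
        using q t s by (simp add: fu L_def minv_mult_cancel_right(2)[OF GL GL_extensional[OF GL]])
      finally show "mmap m f (mat_mult m (u t) (q t)) = H s' t" .
    next
      fix t :: real assume t: "t \<in> {0,1}" and const: "\<forall>s\<in>?I. H s t = H 0 t"
      then have tI: "t \<in> ?I" by auto
      \<comment> \<open>At a stationary endpoint the quotient is the identity, hence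
        \<open>x\<close> and with it \<open>y\<close> vanish and the factor \<open>u t\<close> is
        trivial.\<close>
      have "H s' t = H s t" using const s by metis
      then have "F (s', s, t) = mat_one m"
        using minv(1)[OF GL[OF s(1) tI]] by (simp add: F_def)
      then have "u t = mat_one m"
        using y(4)[OF t] by (intro mat_eqI[of _ m]) (auto simp: u_def x_def)
      moreover have "q t \<in> extensional (idx m)"
        using qp tI by (auto simp: mat_path_def intro: GL_extensional)
      ultimately show "mat_mult m (u t) (q t) = q0 t"
        using q t const by (auto simp: L_def mat_mult_one_left)
    qed
    then show ?thesis by blast
  qed
  \<comment> \<open>Steps of \<delta>/2 stay below the modulus \<delta>, and the cap at 1 makes the
    chain end exactly at stage 1.\<close>
  have "\<exists>q. L (min 1 (real n * (\<delta> / 2))) q" for n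
  proof (induction n)
    case 0
    then show ?case using q0 by (auto simp: L_def)
  next
    case (Suc n)
    then obtain q where "L (min 1 (real n * (\<delta> / 2))) q" by blast
    then show ?case
      by (rule step[rotated 3]) (use \<delta>(1) in \<open>auto simp: min_def algebra_simps\<close>)
  qed
  moreover obtain n where "1 \<le> real n * (\<delta> / 2)"
    using \<delta>(1) reals_Archimedean3[of "\<delta> / 2"] by (meson half_gt_zero less_imp_le)
  ultimately obtain q where "L 1 q" by (metis min.absorb1)
  show ?thesis
  proof (rule that[of q])
    show "mat_path m UNIV q" and "\<And>t. t \<in> {0..1} \<Longrightarrow> mmap m f (q t) = H 1 t"
      using \<open>L 1 q\<close> unfolding L_def by blast+
    fix t :: real assume t: "t \<in> {0,1}" and "\<And>s. s \<in> {0..1} \<Longrightarrow> H s t = H 0 t"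
    then have "\<forall>s\<in>{0..1}. H s t = H 0 t" by blast
    then show "q t = q0 t" using \<open>L 1 q\<close> t unfolding L_def by blast
  qed
qed


section \<open>Decoding the stable ranks\<close>

text \<open>The infimum of a nonempty set of naturals is attained, while the empty set gives
  infinity; a finite bound therefore releases the property at every size from \<open>n\<close>
  on.\<close>

lemma least_stable_le_iff:
  "least_stable P \<le> enat n \<longleftrightarrow> n \<ge> 1 \<and> (\<forall>m\<ge>n. P m)"
proof
  let ?S = "{n. n \<ge> 1 \<and> (\<forall>m\<ge>n. P m)}"
  assume le: "least_stable P \<le> enat n"
  have "least_stable P = \<infinity>" if "?S = {}"
    unfolding least_stable_def that by (simp add: Inf_enat_def)
  with le have "?S \<noteq> {}" by force
  then have "Inf (enat ` ?S) \<in> enat ` ?S"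
    unfolding Inf_enat_def using LeastI_ex[of "\<lambda>x. x \<in> enat ` ?S"] by auto
  then obtain k where k: "k \<in> ?S" "least_stable P = enat k"
    unfolding least_stable_def by blast
  then show "n \<ge> 1 \<and> (\<forall>m\<ge>n. P m)" using le by auto
next
  assume "n \<ge> 1 \<and> (\<forall>m\<ge>n. P m)"
  then show "least_stable P \<le> enat n"
    unfolding least_stable_def by (intro Inf_lower) auto
qed

section \<open>Homotopy classes of spheroids and the maps induced on them\<close>

lemma equiv_spheroid_homotopy: "equiv (spheroids k X p) (spheroid_homotopy k X p)"
proof (rule equivI)
  show "spheroid_homotopy k X p \<subseteq> spheroids k X p \<times> spheroids k X p"
    by (auto simp: spheroid_homotopy_def)
  show "refl_on (spheroids k X p) (spheroid_homotopy k X p)"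
    by (rule refl_onI) (auto simp: spheroid_homotopy_def spheroids_def)
  show "sym (spheroid_homotopy k X p)"
    by (rule symI) (auto simp: spheroid_homotopy_def intro: homotopic_with_symD)
  show "trans (spheroid_homotopy k X p)"
    by (rule transI) (auto simp: spheroid_homotopy_def intro: homotopic_with_trans)
qed

lemma spheroid_homotopy_compose:
  assumes h: "continuous_map X Y h" "h p = q" and f: "(f, f') \<in> spheroid_homotopy k X p"
  shows "(h \<circ> f, h \<circ> f') \<in> spheroid_homotopy k Y q"
  using f h(2) unfolding spheroid_homotopy_def
  by (auto simp: spheroids_def intro: continuous_map_compose[OF _ h(1)]
      elim!: homotopic_with_compose_continuous_map_left[OF _ h(1)])

text \<open>\<open>homotopy_group_map\<close> composes with every representative of a class. Since
  \<open>h\<close> respects homotopies, the results all lie in one class, so a single representative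
  computes the map.\<close>

lemma homotopy_group_map_class:
  assumes h: "continuous_map X Y h" "h p = q" and f: "f \<in> spheroids k X p"
  shows "homotopy_group_map k Y q h (spheroid_homotopy k X p `` {f}) =
    spheroid_homotopy k Y q `` {h \<circ> f}"
proof -
  note X = equiv_spheroid_homotopy[of k X p] and Y = equiv_spheroid_homotopy[of k Y q]
  have "spheroid_homotopy k Y q `` {h \<circ> f'} = spheroid_homotopy k Y q `` {h \<circ> f}"
    if "f' \<in> spheroid_homotopy k X p `` {f}" for f'
    using equiv_class_eq[OF Y spheroid_homotopy_compose[OF h]] that by blast
  moreover have "f \<in> spheroid_homotopy k X p `` {f}"
    by (rule equiv_class_self[OF X f])
  ultimately show ?thesis
    unfolding homotopy_group_map_def by blast
qed

lemma homotopy_group_map_injD: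
  assumes h: "continuous_map X Y h" "h p = q"
    and inj: "inj_on (homotopy_group_map k Y q h) (homotopy_group k X p)"
    and f: "f \<in> spheroids k X p" and f': "f' \<in> spheroids k X p"
    and hom: "(h \<circ> f, h \<circ> f') \<in> spheroid_homotopy k Y q"
  shows "(f, f') \<in> spheroid_homotopy k X p"
proof -
  have "homotopy_group_map k Y q h (spheroid_homotopy k X p `` {f}) =
      homotopy_group_map k Y q h (spheroid_homotopy k X p `` {f'})"
    unfolding homotopy_group_map_class[OF h f] homotopy_group_map_class[OF h f']
    by (rule equiv_class_eq[OF equiv_spheroid_homotopy hom])
  then have "spheroid_homotopy k X p `` {f} = spheroid_homotopy k X p `` {f'}"
    by (rule inj_onD[OF inj]) (auto simp: homotopy_group_def intro: quotientI f f')
  then show ?thesis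
    by (rule eq_equiv_class[OF _ equiv_spheroid_homotopy f'])
qed

lemma homotopy_group_map_surjD:
  assumes h: "continuous_map X Y h" "h p = q"
    and surj: "homotopy_group_map k Y q h ` homotopy_group k X p = homotopy_group k Y q"
    and g: "g \<in> spheroids k Y q"
  obtains f where "f \<in> spheroids k X p" "(h \<circ> f, g) \<in> spheroid_homotopy k Y q"
proof -
  have "spheroid_homotopy k Y q `` {g} \<in> homotopy_group_map k Y q h ` homotopy_group k X p"
    unfolding surj by (simp add: homotopy_group_def quotientI[OF g])
  then obtain c where c: "c \<in> homotopy_group k X p"
    "spheroid_homotopy k Y q `` {g} = homotopy_group_map k Y q h c" by blast
  from c(1) obtain f where f: "f \<in> spheroids k X p" "c = spheroid_homotopy k X p `` {f}"
    unfolding homotopy_group_def by (rule quotientE)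
  have "spheroid_homotopy k Y q `` {h \<circ> f} = spheroid_homotopy k Y q `` {g}"
    using c(2) unfolding f(2) homotopy_group_map_class[OF h f(1)] by simp
  then have "(h \<circ> f, g) \<in> spheroid_homotopy k Y q"
    by (rule eq_equiv_class[OF _ equiv_spheroid_homotopy g])
  with f(1) show ?thesis by (rule that)
qed

section \<open>Cubes of dimension 0 and 1\<close>

lemma topspace_cube_0: "topspace (cube 0) = {\<lambda>i. undefined}"
  by (simp add: cube_def)

text \<open>The 0-cube is one point with empty boundary, so a homotopy is a path. Points are
  represented by functions constant everywhere, since \<open>homotopic_with\<close> prescribes its
  end maps also outside the cube.\<close>

lemma spheroid_homotopy_0_iff:
  "((\<lambda>_. x), (\<lambda>_. y)) \<in> spheroid_homotopy 0 X p \<longleftrightarrow>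
    (\<exists>r. continuous_map (top_of_set {0..1}) X r \<and> r 0 = x \<and> r (1::real) = y)"
proof
  assume "((\<lambda>_. x), (\<lambda>_. y)) \<in> spheroid_homotopy 0 X p"
  then obtain h :: "real \<times> (nat \<Rightarrow> real) \<Rightarrow> 'a"
    where h: "continuous_map (prod_topology (top_of_set {0..1}) (cube 0)) X h"
      "\<forall>z. h (0, z) = x" "\<forall>z. h (1, z) = y"
    by (auto simp: spheroid_homotopy_def homotopic_with_def)
  have "continuous_map (top_of_set {0..1::real}) (prod_topology (top_of_set {0..1}) (cube 0))
      (\<lambda>t. (t, \<lambda>i. undefined))"
    by (intro continuous_map_pairedI) (simp_all add: topspace_cube_0 continuous_map_from_subtopology)
  from continuous_map_compose[OF this h(1)] h(2,3)
  show "\<exists>r. continuous_map (top_of_set {0..1}) X r \<and> r 0 = x \<and> r (1::real) = y"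
    by (intro exI[of _ "h \<circ> (\<lambda>t. (t, \<lambda>i. undefined))"]) simp
next
  assume "\<exists>r. continuous_map (top_of_set {0..1}) X r \<and> r 0 = x \<and> r (1::real) = y"
  then obtain r where r: "continuous_map (top_of_set {0..1}) X r" "r 0 = x" "r (1::real) = y"
    by blast
  have "x \<in> topspace X" "y \<in> topspace X"
    using continuous_map_image_subset_topspace[OF r(1)] r(2,3) by (auto simp: image_subset_iff)
  moreover have "continuous_map (prod_topology (top_of_set {0..1}) (cube 0)) X (r \<circ> fst)"
    by (rule continuous_map_compose[OF continuous_map_fst r(1)])
  ultimately show "((\<lambda>_. x), (\<lambda>_. y)) \<in> spheroid_homotopy 0 X p"
    using r(2,3)
    by (auto simp: spheroid_homotopy_def spheroids_def cube_boundary_def homotopic_with_def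
        intro!: exI[of _ "r \<circ> fst"])
qed

text \<open>The 1-cube consists of extensional functions on \<open>{..<1}\<close>; this is its
  identification with the interval, inverse to evaluation at 0.\<close>

definition cube_point :: "real \<Rightarrow> nat \<Rightarrow> real" where
  "cube_point t = (\<lambda>i\<in>{..<1}. t)"

lemma continuous_map_cube_point: "continuous_map (top_of_set {0..1}) (cube 1) cube_point"
  unfolding cube_def cube_point_def continuous_map_componentwise
  by (auto simp: continuous_map_in_subtopology)

lemma cube_point_boundary: "cube_point 0 \<in> cube_boundary 1" "cube_point 1 \<in> cube_boundary 1"
  by (auto simp: cube_boundary_def cube_def cube_point_def)

lemma loop_spheroid:
  assumes "continuous_map (top_of_set {0..1}) X r" "r 0 = p" "r (1::real) = p"
  shows "(\<lambda>x. r (x 0)) \<in> spheroids 1 X p"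
proof -
  have "continuous_map (cube 1) (top_of_set {0..1}) (\<lambda>x. x 0)"
    unfolding cube_def
    using continuous_map_product_projection[of 0 "{..<1::nat}" "\<lambda>_. top_of_set {0..1::real}"] by simp
  from continuous_map_compose[OF this assms(1)] show ?thesis
    using assms(2,3) by (auto simp: spheroids_def cube_boundary_def o_def)
qed


section \<open>Stabilization\<close>

lemma mat_embed_apply:
  "i < Suc n \<Longrightarrow> j < Suc n \<Longrightarrow>
    mat_embed n a (i, j) = (if i < n \<and> j < n then a (i, j) else if i = j then 1 else 0)"
  by (simp add: mat_embed_def)

lemma mat_embed_extensional [simp]: "mat_embed n a \<in> extensional (idx (Suc n))"
  by (simp add: mat_embed_def)

lemma mat_embed_mult:
  "mat_embed n (mat_mult n a b) = mat_mult (Suc n) (mat_embed n a) (mat_embed n b)"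
proof (rule mat_eqI[of _ "Suc n"])
  fix i j assume ij: "i < Suc n" "j < Suc n"
  have "(\<Sum>k<n. mat_embed n a (i, k) * mat_embed n b (k, j)) =
      (if i < n \<and> j < n then \<Sum>k<n. a (i, k) * b (k, j) else 0)"
    using ij by (auto simp: mat_embed_apply intro!: sum.neutral)
  then show "mat_embed n (mat_mult n a b) (i, j) =
      mat_mult (Suc n) (mat_embed n a) (mat_embed n b) (i, j)"
    using ij by (auto simp: mat_mult_apply mat_embed_apply)
qed auto

lemma mat_embed_one: "mat_embed n (mat_one n) = mat_one (Suc n)"
  by (rule mat_eqI[of _ "Suc n"]) (auto simp: mat_embed_apply mat_one_apply)

lemma (in closed_subalgebra) mat_embed_GL:
  assumes g: "g \<in> GL n A"
  shows "mat_embed n g \<in> GL (Suc n) A"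
proof -
  have PiE: "mat_embed n a \<in> idx (Suc n) \<rightarrow>\<^sub>E A" if "a \<in> idx n \<rightarrow>\<^sub>E A" for a
    using that by (intro PiE_I) (auto simp: mat_embed_def zero one PiE_iff)
  have "mat_mult (Suc n) (mat_embed n g) (mat_embed n (minv n g)) = mat_one (Suc n)"
    "mat_mult (Suc n) (mat_embed n (minv n g)) (mat_embed n g) = mat_one (Suc n)"
    using minv[OF g] by (simp_all add: mat_embed_one flip: mat_embed_mult)
  then show ?thesis
    using PiE[OF GL_PiE[OF g]] PiE[OF GL_PiE[OF minv(3)[OF g]]] by (auto simp: GL_iff)
qed

text \<open>The corner of an inverse of diag(\<open>a\<close>, 1) inverts \<open>a\<close>: row and
  column \<open>n\<close> of diag(\<open>a\<close>, 1) are zero off the diagonal, so the index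
  \<open>n\<close> contributes nothing to the corner of either product.\<close>

lemma mat_embed_GL_D:
  assumes a: "a \<in> idx n \<rightarrow>\<^sub>E A" and GL: "mat_embed n a \<in> GL (Suc n) A"
  shows "a \<in> GL n A"
proof -
  obtain c where c: "c \<in> idx (Suc n) \<rightarrow>\<^sub>E A" "mat_mult (Suc n) (mat_embed n a) c = mat_one (Suc n)"
    "mat_mult (Suc n) c (mat_embed n a) = mat_one (Suc n)"
    using GL by (auto simp: GL_iff)
  let ?c = "restrict c (idx n)"
  have "mat_mult n a ?c = mat_one n"
  proof (rule mat_eqI[of _ n])
    fix i j assume ij: "i < n" "j < n"
    have "mat_mult n a ?c (i, j) = mat_mult (Suc n) (mat_embed n a) c (i, j)"
      using ij by (simp add: mat_mult_apply mat_embed_apply)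
    then show "mat_mult n a ?c (i, j) = mat_one n (i, j)"
      using ij c(2) by (simp add: mat_one_apply)
  qed auto
  moreover have "mat_mult n ?c a = mat_one n"
  proof (rule mat_eqI[of _ n])
    fix i j assume ij: "i < n" "j < n"
    have "mat_mult n ?c a (i, j) = mat_mult (Suc n) c (mat_embed n a) (i, j)"
      using ij by (simp add: mat_mult_apply mat_embed_apply)
    then show "mat_mult n ?c a (i, j) = mat_one n (i, j)"
      using ij c(3) by (simp add: mat_one_apply)
  qed auto
  moreover have "?c \<in> idx n \<rightarrow>\<^sub>E A" using c(1) by (auto simp: PiE_iff)
  ultimately show ?thesis using a unfolding GL_iff by blast
qed

lemma (in closed_subalgebra) continuous_map_mat_embed:
  "continuous_map (GL_top n A) (GL_top (Suc n) A) (mat_embed n)"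
  unfolding continuous_map_into_GL_top
proof (intro conjI ballI)
  have coord: "continuous_map (GL_top n A) euclidean (\<lambda>h. h q)" if "q \<in> idx n" for q
    using continuous_map_id[of "GL_top n A"] that unfolding continuous_map_into_GL_top id_apply by blast
  fix q assume "q \<in> idx (Suc n)"
  then obtain i j where q: "q = (i, j)" "i < Suc n" "j < Suc n" by auto
  show "continuous_map (GL_top n A) euclidean (\<lambda>t. mat_embed n t q)"
    using coord[of q] q by (cases "i < n \<and> j < n") (auto simp: mat_embed_apply)
qed (auto intro: mat_embed_GL)

lemma (in closed_subalgebra) mat_path_embed:
  "mat_path n A p \<Longrightarrow> mat_path (Suc n) A (\<lambda>t. mat_embed n (p t))"
  unfolding mat_path_iff
  using continuous_map_compose[OF _ continuous_map_mat_embed, of "top_of_set {0..1}" n p]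
  by (simp add: o_def)

lemma (in closed_subalgebra) mat_embed_GL0:
  assumes "g \<in> GL0 n A"
  shows "mat_embed n g \<in> GL0 (Suc n) A"
proof -
  obtain p where "mat_path n A p" "p 0 = mat_one n" "p 1 = g"
    using assms by (auto simp: GL0_iff_path)
  then show ?thesis
    unfolding GL0_iff_path
    by (intro exI[of _ "\<lambda>t. mat_embed n (p t)"]) (simp add: mat_path_embed mat_embed_one)
qed

lemma (in subalgebra_hom) mmap_embed: "mmap (Suc n) f (mat_embed n a) = mat_embed n (mmap n f a)"
  by (rule mat_eqI[of _ "Suc n"]) (auto simp: mmap_apply mat_embed_apply hom_one hom_zero)

text \<open>Injectivity is applied to the classes of \<open>mat_one n\<close> and \<open>d\<close>,
  which merge one size up. Classes in degree 0 are path components, so the passage to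
  \<open>GL0\<close> rests on \<open>GL0_iff_path\<close>.\<close>

lemma (in closed_subalgebra) stabilization_inj_0D:
  assumes inj: "inj_on (GL_stabilization 0 (Suc n) A) (GL_homotopy_group 0 n A)"
    and d: "d \<in> GL n A" and emb: "mat_embed n d \<in> GL0 (Suc n) A"
  shows "d \<in> GL0 n A"
proof -
  obtain r where r: "mat_path (Suc n) A r" "r 0 = mat_one (Suc n)" "r 1 = mat_embed n d"
    using emb by (auto simp: GL0_iff_path)
  have "((\<lambda>_. mat_one n), (\<lambda>_. d)) \<in> spheroid_homotopy 0 (GL_top n A) (mat_one n)"
  proof (rule homotopy_group_map_injD)
    show "continuous_map (GL_top n A) (GL_top (Suc n) A) (mat_embed n)"
      by (rule continuous_map_mat_embed)
    show "mat_embed n (mat_one n) = mat_one (Suc n)" by (rule mat_embed_one)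
    show "inj_on (homotopy_group_map 0 (GL_top (Suc n) A) (mat_one (Suc n)) (mat_embed n))
        (homotopy_group 0 (GL_top n A) (mat_one n))"
      using inj by (simp add: GL_stabilization_def GL_homotopy_group_def)
    show "(\<lambda>_. mat_one n) \<in> spheroids 0 (GL_top n A) (mat_one n)"
      "(\<lambda>_. d) \<in> spheroids 0 (GL_top n A) (mat_one n)"
      using d GL_one by (auto simp: spheroids_def cube_boundary_def)
    show "(mat_embed n \<circ> (\<lambda>_. mat_one n), mat_embed n \<circ> (\<lambda>_. d))
        \<in> spheroid_homotopy 0 (GL_top (Suc n) A) (mat_one (Suc n))"
      unfolding o_def spheroid_homotopy_0_iff
      using r by (auto simp: mat_path_iff mat_embed_one intro!: exI[of _ r])
  qed
  then show ?thesis
    unfolding spheroid_homotopy_0_iff GL0_iff_path mat_path_iff .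
qed

text \<open>Brings surjectivity on loops into the form that homotopy lifting consumes: two real
  parameters in place of a cube coordinate, with both ends of the loop held fixed during the
  deformation.\<close>

lemma (in closed_subalgebra) stabilization_surj_1D:
  assumes surj: "GL_stabilization 1 (Suc n) A ` GL_homotopy_group 1 n A = GL_homotopy_group 1 (Suc n) A"
    and r: "mat_path (Suc n) A r" "r 0 = mat_one (Suc n)" "r 1 = mat_one (Suc n)"
  obtains l :: "real \<Rightarrow> nat \<times> nat \<Rightarrow> 'a" and H :: "real \<Rightarrow> real \<Rightarrow> nat \<times> nat \<Rightarrow> 'a"
  where "mat_path n A l" "l 0 = mat_one n" "l 1 = mat_one n"
    "mat_continuous_on ({0..1} \<times> {0..1}) (Suc n) (\<lambda>(s, t). H s t)"
    "\<forall>s\<in>{0..1}. \<forall>t\<in>{0..1}. H s t \<in> GL (Suc n) A"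
    "\<forall>t\<in>{0..1}. H 0 t = mat_embed n (l t) \<and> H 1 t = r t"
    "\<forall>s\<in>{0..1}. H s 0 = mat_one (Suc n) \<and> H s 1 = mat_one (Suc n)"
proof -
  have "(\<lambda>x. r (x 0)) \<in> spheroids 1 (GL_top (Suc n) A) (mat_one (Suc n))"
    by (rule loop_spheroid) (use r in \<open>simp_all add: mat_path_iff\<close>)
  moreover have "homotopy_group_map 1 (GL_top (Suc n) A) (mat_one (Suc n)) (mat_embed n) `
      homotopy_group 1 (GL_top n A) (mat_one n) = homotopy_group 1 (GL_top (Suc n) A) (mat_one (Suc n))"
    using surj by (simp add: GL_stabilization_def GL_homotopy_group_def)
  ultimately obtain f where f: "f \<in> spheroids 1 (GL_top n A) (mat_one n)"
    "(mat_embed n \<circ> f, \<lambda>x. r (x 0)) \<in> spheroid_homotopy 1 (GL_top (Suc n) A) (mat_one (Suc n))"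
    using homotopy_group_map_surjD[OF continuous_map_mat_embed[of n], OF mat_embed_one[of n]] by metis
  then obtain h :: "real \<times> (nat \<Rightarrow> real) \<Rightarrow> nat \<times> nat \<Rightarrow> 'a"
    where h: "continuous_map (prod_topology (top_of_set {0..1}) (cube 1)) (GL_top (Suc n) A) h"
      "\<forall>x. h (0, x) = mat_embed n (f x)" "\<forall>x. h (1, x) = r (x 0)"
      "\<forall>s\<in>{0..1}. \<forall>x\<in>cube_boundary 1. h (s, x) = mat_one (Suc n)"
    by (auto simp: spheroid_homotopy_def homotopic_with_def)
  have "continuous_map (top_of_set ({0..1} \<times> {0..1})) (prod_topology (top_of_set {0..1}) (cube 1))
      (\<lambda>x. (fst x, cube_point (snd x)))"
    unfolding prod_topology_subtopology_eu[symmetric]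
    by (intro continuous_map_pairedI continuous_map_fst
        continuous_map_compose[OF continuous_map_snd continuous_map_cube_point, unfolded o_def])
  from continuous_map_compose[OF this h(1)]
  have H: "continuous_map (top_of_set ({0..1} \<times> {0..1})) (GL_top (Suc n) A)
      (\<lambda>(s, t). h (s, cube_point t))"
    by (simp add: o_def split_def)
  have l: "continuous_map (top_of_set {0..1}) (GL_top n A) (\<lambda>t. f (cube_point t))"
    using continuous_map_compose[OF continuous_map_cube_point, of "GL_top n A" f] f(1)
    by (simp add: spheroids_def o_def)
  show ?thesis
  proof (rule that[of "\<lambda>t. f (cube_point t)" "\<lambda>s t. h (s, cube_point t)"])
    show "mat_path n A (\<lambda>t. f (cube_point t))" using l by (simp add: mat_path_iff)
    show "f (cube_point 0) = mat_one n" "f (cube_point 1) = mat_one n"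
      using f(1) cube_point_boundary by (auto simp: spheroids_def)
    show "mat_continuous_on ({0..1} \<times> {0..1}) (Suc n) (\<lambda>(s, t). h (s, cube_point t))"
      using H by (simp add: continuous_map_GL_top_iff)
    show "\<forall>s\<in>{0..1}. \<forall>t\<in>{0..1}. h (s, cube_point t) \<in> GL (Suc n) A"
      using H by (auto simp: continuous_map_GL_top_iff)
    show "\<forall>s\<in>{0..1}. h (s, cube_point 0) = mat_one (Suc n) \<and> h (s, cube_point 1) = mat_one (Suc n)"
      using h(4) cube_point_boundary by blast
  qed (use h(2,3) in \<open>simp add: cube_point_def\<close>)
qed


section \<open>Path lifting\<close>

text \<open>The family \<open>p (s * t)\<close> contracts the path to its start: stage 0 is constant
  and lifts trivially, stage 1 is \<open>p\<close>, and at \<open>t = 0\<close> nothing moves, so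
  the lift still begins at the identity.\<close>

lemma mat_path_lift:
  fixes f :: "'c::unital_cstar_algebra \<Rightarrow> 'd::unital_cstar_algebra"
  assumes f: "unital_star_hom f" and surj: "surj f"
    and p: "mat_path m UNIV p" "p 0 = mat_one m"
  obtains q where "mat_path m UNIV q" "q 0 = mat_one m"
    "\<And>t. t \<in> {0..1} \<Longrightarrow> mmap m f (q t) = p t"
proof -
  interpret f: subalgebra_hom UNIV UNIV f by (rule star_hom_subalgebra_hom[OF f])
  have "mat_continuous_on ({0..1} \<times> {0..1}) m (\<lambda>x. p (fst x * snd x))"
  proof (rule mat_continuous_on_compose)
    show "mat_continuous_on {0..1} m p" using p(1) by (simp add: mat_path_def)
    show "continuous_on ({0..1} \<times> {0..1}) (\<lambda>x. fst x * snd x :: real)" by (intro continuous_intros)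
  qed (auto intro: mult_le_one)
  then have cont: "mat_continuous_on ({0..1} \<times> {0..1}) m (\<lambda>(s, t). p (s * t))"
    by (simp add: split_def)
  have GL: "p (s * t) \<in> GL m UNIV" if "s \<in> {0..1}" "t \<in> {0..1}" for s t :: real
  proof -
    have "s * t \<in> {0..1}" using that by (auto intro: mult_le_one)
    then show ?thesis using p(1) by (simp add: mat_path_def)
  qed
  have base: "mat_path m UNIV (\<lambda>t. mat_one m :: nat \<times> nat \<Rightarrow> 'c)"
    by (rule mat_path_const[OF UNIV_subalgebra.GL_one])
  obtain q where q: "mat_path m UNIV q" "\<And>t. t \<in> {0..1} \<Longrightarrow> mmap m f (q t) = p (1 * t)"
    "\<And>t. t \<in> {0,1} \<Longrightarrow> (\<And>s. s \<in> {0..1} \<Longrightarrow> p (s * t) = p (0 * t)) \<Longrightarrow> q t = mat_one m"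
    by (rule GL_homotopy_lift[OF f surj cont GL base]) (auto simp: p(2) f.mmap_one)
  show ?thesis
    by (rule that[of q]) (use q in auto)
qed

lemma GL0_lift:
  fixes f :: "'c::unital_cstar_algebra \<Rightarrow> 'd::unital_cstar_algebra"
  assumes f: "unital_star_hom f" and surj: "surj f" and d: "d \<in> GL0 m UNIV"
  obtains k where "k \<in> GL0 m UNIV" "mmap m f k = d"
proof -
  obtain p where p: "mat_path m UNIV p" "p 0 = mat_one m" "p 1 = d"
    using d by (auto simp: UNIV_subalgebra.GL0_iff_path)
  obtain q where "mat_path m UNIV q" "q 0 = mat_one m" "\<And>t. t \<in> {0..1} \<Longrightarrow> mmap m f (q t) = p t"
    using mat_path_lift[OF f surj p(1,2)] by blast
  then show ?thesis
    using p(3) by (intro that[of "q 1"]) (auto simp: UNIV_subalgebra.GL0_iff_path)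
qed


section \<open>Stabilizer of the last unit vector\<close>

definition last_unit :: "nat \<Rightarrow> nat \<Rightarrow> 'a::unital_cstar_algebra" where
  "last_unit n = (\<lambda>i\<in>{..<Suc n}. if i = n then 1 else 0)"

definition vmap :: "nat \<Rightarrow> ('a \<Rightarrow> 'b) \<Rightarrow> (nat \<Rightarrow> 'a) \<Rightarrow> nat \<Rightarrow> 'b" where
  "vmap m f v = (\<lambda>i\<in>{..<m}. f (v i))"

text \<open>Unipotent matrices that differ from the identity only in the last row; together with the
  embedded corner they generate the stabilizer of \<open>last_unit n\<close>.\<close>

definition lower_row :: "nat \<Rightarrow> (nat \<Rightarrow> 'a) \<Rightarrow> nat \<times> nat \<Rightarrow> 'a::unital_cstar_algebra" where
  "lower_row n w = (\<lambda>(i, j)\<in>idx (Suc n). if i = n \<and> j < n then w j else if i = j then 1 else 0)"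

lemma vec_eqI:
  assumes "v \<in> extensional {..<m}" "w \<in> extensional {..<m}" "\<And>i. i < m \<Longrightarrow> v i = w i"
  shows "v = w"
  using assms by (intro extensionalityI[of v "{..<m}" w]) auto

lemma mat_vec_apply: "i < m \<Longrightarrow> mat_vec m a v i = (\<Sum>k<m. a (i, k) * v k)"
  by (simp add: mat_vec_def)

lemma mat_vec_extensional [simp]: "mat_vec m a v \<in> extensional {..<m}"
  by (simp add: mat_vec_def)

lemma mat_vec_mult: "mat_vec m (mat_mult m a b) v = mat_vec m a (mat_vec m b v)"
proof (rule vec_eqI[of _ m])
  fix i assume i: "i < m"
  have "mat_vec m (mat_mult m a b) v i = (\<Sum>k<m. \<Sum>l<m. a (i, l) * b (l, k) * v k)"
    using i by (simp add: mat_vec_apply mat_mult_apply sum_distrib_right)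
  also have "\<dots> = (\<Sum>l<m. \<Sum>k<m. a (i, l) * b (l, k) * v k)"
    by (rule sum.swap)
  also have "\<dots> = mat_vec m a (mat_vec m b v) i"
    using i by (simp add: mat_vec_apply sum_distrib_left mult.assoc)
  finally show "mat_vec m (mat_mult m a b) v i = mat_vec m a (mat_vec m b v) i" .
qed auto

lemma mat_vec_one:
  assumes "v \<in> extensional {..<m}"
  shows "mat_vec m (mat_one m) v = v"
proof (rule vec_eqI[of _ m])
  fix i assume "i < m"
  then show "mat_vec m (mat_one m) v i = v i"
    by (simp add: mat_vec_apply mat_one_apply if_distrib[of "\<lambda>x. x * _"] cong: if_cong)
qed (use assms in auto)

lemma mat_vec_minv:
  assumes "g \<in> GL m A" "v \<in> extensional {..<m}" "mat_vec m g v = w"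
  shows "mat_vec m (minv m g) w = v"
  using assms(2,3) mat_vec_mult[of m "minv m g" g v]
  by (simp add: minv(2)[OF assms(1)] mat_vec_one)

lemma vmap_extensional [simp]: "vmap m f v \<in> extensional {..<m}"
  by (simp add: vmap_def)

lemma vmap_PiE_UNIV: "vmap m f v \<in> {..<m} \<rightarrow>\<^sub>E UNIV"
  by (simp add: vmap_def)

lemma last_unit_extensional [simp]: "last_unit n \<in> extensional {..<Suc n}"
  by (simp add: last_unit_def)

lemma mat_vec_last_unit: "i < Suc n \<Longrightarrow> mat_vec (Suc n) a (last_unit n) i = a (i, n)"
  by (simp add: mat_vec_apply last_unit_def)

lemma lower_row_apply:
  "i < Suc n \<Longrightarrow> j < Suc n \<Longrightarrow>
    lower_row n w (i, j) = (if i = n \<and> j < n then w j else if i = j then 1 else 0)"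
  by (simp add: lower_row_def)

lemma lower_row_extensional [simp]: "lower_row n w \<in> extensional (idx (Suc n))"
  by (simp add: lower_row_def)

lemma lower_row_zero: "lower_row n (\<lambda>j. 0) = mat_one (Suc n)"
  by (rule mat_eqI[of _ "Suc n"]) (auto simp: lower_row_apply mat_one_apply)

lemma lower_row_mult:
  "mat_mult (Suc n) (lower_row n v) (lower_row n w) = lower_row n (\<lambda>j. v j + w j)"
proof (rule mat_eqI[of _ "Suc n"])
  fix i j assume ij: "i < Suc n" "j < Suc n"
  have "(\<Sum>k<n. lower_row n v (i, k) * lower_row n w (k, j)) =
      (\<Sum>k<n. if k = j then lower_row n v (i, j) else 0)"
    by (rule sum.cong) (use ij in \<open>auto simp: lower_row_apply\<close>)
  then have "mat_mult (Suc n) (lower_row n v) (lower_row n w) (i, j) =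
      (if j < n then lower_row n v (i, j) else 0) + lower_row n v (i, n) * lower_row n w (n, j)"
    using ij by (simp add: mat_mult_apply)
  then show "mat_mult (Suc n) (lower_row n v) (lower_row n w) (i, j) = lower_row n (\<lambda>j. v j + w j) (i, j)"
    using ij by (auto simp: lower_row_apply)
qed auto

text \<open>Multiplication adds the rows, so negating \<open>w\<close> inverts the matrix, and
  scaling \<open>w\<close> down to 0 gives a path to the identity.\<close>

lemma lower_row_GL0: "lower_row n w \<in> GL0 (Suc n) (UNIV :: 'a::unital_cstar_algebra set)"
proof -
  have GL: "lower_row n v \<in> GL (Suc n) UNIV" for v :: "nat \<Rightarrow> 'a"
    using lower_row_mult[of n v "\<lambda>j. - v j"] lower_row_mult[of n "\<lambda>j. - v j" v]
    by (auto simp: GL_iff lower_row_zero PiE_def intro!: bexI[of _ "lower_row n (\<lambda>j. - v j)"])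
  have "mat_path (Suc n) UNIV (\<lambda>t. lower_row n (\<lambda>j. t *\<^sub>R w j))"
    unfolding mat_path_def mat_continuous_on_def
  proof (intro conjI ballI GL)
    fix q assume "q \<in> idx (Suc n)"
    then obtain i j where q: "q = (i, j)" "i < Suc n" "j < Suc n" by auto
    show "continuous_on {0..1} (\<lambda>t::real. lower_row n (\<lambda>j. t *\<^sub>R w j) q)"
      unfolding q(1) lower_row_apply[OF q(2,3)]
      by (cases "i = n \<and> j < n") (auto intro!: continuous_intros)
  qed
  then show ?thesis
    unfolding UNIV_subalgebra.GL0_iff_path
    by (intro exI[of _ "\<lambda>t. lower_row n (\<lambda>j. t *\<^sub>R w j)"]) (simp add: lower_row_zero)
qed

lemma lower_row_last_unit: "mat_vec (Suc n) (lower_row n w) (last_unit n) = last_unit n"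
  by (rule vec_eqI[of _ "Suc n"]) (auto simp: mat_vec_last_unit lower_row_apply, simp_all add: last_unit_def)

lemma mat_embed_last_unit: "mat_vec (Suc n) (mat_embed n a) (last_unit n) = last_unit n"
  by (rule vec_eqI[of _ "Suc n"]) (auto simp: mat_vec_last_unit mat_embed_apply, simp_all add: last_unit_def)

text \<open>The last column of \<open>d\<close> is forced to be the unit vector, so outside the
  corner only the last row remains to be produced. The right factor supplies it, because row
  \<open>n\<close> of the left factor is the unit row.\<close>

lemma stabilizer_decomposition:
  assumes d: "d \<in> extensional (idx (Suc n))" and fix_last: "mat_vec (Suc n) d (last_unit n) = last_unit n"
  shows "mat_mult (Suc n) (mat_embed n (restrict d (idx n))) (lower_row n (\<lambda>j. d (n, j))) = d"
proof (rule mat_eqI[of _ "Suc n"])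
  fix i j assume ij: "i < Suc n" "j < Suc n"
  have col: "d (k, n) = (if k = n then 1 else 0)" if "k < Suc n" for k
    using mat_vec_last_unit[OF that, of d] that unfolding fix_last by (simp add: last_unit_def)
  let ?e = "mat_embed n (restrict d (idx n))" and ?l = "lower_row n (\<lambda>j. d (n, j))"
  have "(\<Sum>k<n. ?e (i, k) * ?l (k, j)) = (\<Sum>k<n. if k = j then ?e (i, j) else 0)"
    by (rule sum.cong) (use ij in \<open>auto simp: lower_row_apply\<close>)
  then have eq: "mat_mult (Suc n) ?e ?l (i, j) = (if j < n then ?e (i, j) else 0) + ?e (i, n) * ?l (n, j)"
    using ij by (simp add: mat_mult_apply)
  show "mat_mult (Suc n) ?e ?l (i, j) = d (i, j)"
  proof (cases "j < n")
    case True
    then show ?thesis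
      using eq ij by (auto simp: lower_row_apply mat_embed_apply not_less_less_Suc_eq)
  next
    case False
    then have "j = n" using ij by simp
    then show ?thesis
      using eq ij col[OF ij(1)] by (auto simp: lower_row_apply mat_embed_apply)
  qed
qed (use d in auto)

context subalgebra_hom begin

lemma mmap_lower_row: "mmap (Suc n) f (lower_row n w) = lower_row n (\<lambda>j. f (w j))"
  by (rule mat_eqI[of _ "Suc n"]) (auto simp: mmap_apply lower_row_apply hom_one hom_zero)

lemma vmap_last_unit: "vmap (Suc n) f (last_unit n) = last_unit n"
  by (auto simp: vmap_def last_unit_def hom_one hom_zero fun_eq_iff)

lemma mat_vec_mmap:
  assumes "a \<in> idx m \<rightarrow>\<^sub>E A" "v \<in> {..<m} \<rightarrow>\<^sub>E A"
  shows "mat_vec m (mmap m f a) (vmap m f v) = vmap m f (mat_vec m a v)"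
proof (rule vec_eqI[of _ m])
  fix i assume i: "i < m"
  then have aA: "a (i, k) \<in> A" and vA: "v k \<in> A" if "k < m" for k
    using assms that by (auto simp: PiE_iff)
  have "mat_vec m (mmap m f a) (vmap m f v) i = (\<Sum>k<m. f (a (i, k) * v k))"
    using i by (simp add: mat_vec_apply mmap_apply vmap_def hom_mult aA vA)
  also have "\<dots> = f (\<Sum>k<m. a (i, k) * v k)"
    by (rule hom_sum[symmetric]) (simp add: aA vA A.mult)
  also have "\<dots> = vmap m f (mat_vec m a v) i"
    using i by (simp add: vmap_def mat_vec_apply)
  finally show "mat_vec m (mmap m f a) (vmap m f v) i = vmap m f (mat_vec m a v) i" .
qed auto

end

section \<open>Unimodular vectors and transitivity\<close>

lemma (in closed_subalgebra) Lg_iff: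
  "x \<in> Lg m A \<longleftrightarrow> x \<in> {..<m} \<rightarrow>\<^sub>E A \<and> (\<exists>b\<in>{..<m} \<rightarrow>\<^sub>E A. (\<Sum>i<m. b i * x i) = 1)"
proof (intro iffI conjI)
  assume x: "x \<in> Lg m A"
  then show "x \<in> {..<m} \<rightarrow>\<^sub>E A" by (simp add: Lg_def)
  have "1 \<in> {\<Sum>i<m. b i * x i | b. b \<in> {..<m} \<rightarrow>\<^sub>E A}"
    using x one by (simp add: Lg_def)
  then show "\<exists>b\<in>{..<m} \<rightarrow>\<^sub>E A. (\<Sum>i<m. b i * x i) = 1" by force
next
  assume "x \<in> {..<m} \<rightarrow>\<^sub>E A \<and> (\<exists>b\<in>{..<m} \<rightarrow>\<^sub>E A. (\<Sum>i<m. b i * x i) = 1)"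
  then obtain b where x: "x \<in> {..<m} \<rightarrow>\<^sub>E A" and b: "b \<in> {..<m} \<rightarrow>\<^sub>E A" "(\<Sum>i<m. b i * x i) = 1"
    by blast
  have xA: "x i \<in> A" and bA: "b i \<in> A" if "i < m" for i
    using x b(1) that by (auto simp: PiE_iff)
  have "{\<Sum>i<m. b i * x i | b. b \<in> {..<m} \<rightarrow>\<^sub>E A} = A"
  proof (intro equalityI subsetI)
    fix a assume "a \<in> {\<Sum>i<m. b i * x i | b. b \<in> {..<m} \<rightarrow>\<^sub>E A}"
    then show "a \<in> A" using xA by (auto simp: PiE_iff intro!: sum mult)
  next
    fix a assume a: "a \<in> A"
    have "(\<Sum>i<m. (\<lambda>i\<in>{..<m}. a * b i) i * x i) = a * (\<Sum>i<m. b i * x i)"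
      by (simp add: sum_distrib_left mult.assoc)
    then show "a \<in> {\<Sum>i<m. b i * x i | b. b \<in> {..<m} \<rightarrow>\<^sub>E A}"
      using a bA b(2) by (intro CollectI exI[of _ "\<lambda>i\<in>{..<m}. a * b i"]) (auto intro: mult)
  qed
  then show "x \<in> Lg m A" using x by (simp add: Lg_def)
qed

lemma (in closed_subalgebra) last_unit_Lg: "last_unit n \<in> Lg (Suc n) A"
  unfolding Lg_iff
  by (intro conjI bexI[of _ "last_unit n"]) (auto simp: last_unit_def zero one)

lemma (in subalgebra_hom) vmap_Lg:
  assumes "x \<in> Lg m A"
  shows "vmap m f x \<in> Lg m B"
proof -
  obtain b where x: "x \<in> {..<m} \<rightarrow>\<^sub>E A" and b: "b \<in> {..<m} \<rightarrow>\<^sub>E A" "(\<Sum>i<m. b i * x i) = 1"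
    using assms by (auto simp: A.Lg_iff)
  have xA: "x i \<in> A" and bA: "b i \<in> A" if "i < m" for i
    using x b(1) that by (auto simp: PiE_iff)
  have "(\<Sum>i<m. vmap m f b i * vmap m f x i) = (\<Sum>i<m. f (b i * x i))"
    by (simp add: vmap_def hom_mult xA bA)
  also have "\<dots> = f (\<Sum>i<m. b i * x i)"
    by (rule hom_sum[symmetric]) (simp add: xA bA A.mult)
  finally have "(\<Sum>i<m. vmap m f b i * vmap m f x i) = 1"
    by (simp add: b(2) hom_one)
  then show ?thesis
    unfolding B.Lg_iff using xA bA maps
    by (intro conjI bexI[of _ "vmap m f b"]) (auto simp: vmap_def)
qed

text \<open>An action is transitive once everything can be moved to one base point; the size
  \<open>Suc n\<close> guarantees that there is a last unit vector to serve as one.\<close>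

lemma (in closed_subalgebra) transitive_iff:
  "(\<forall>x\<in>Lg (Suc n) A. \<forall>y\<in>Lg (Suc n) A. \<exists>g\<in>GL0 (Suc n) A. mat_vec (Suc n) g x = y) \<longleftrightarrow>
    (\<forall>x\<in>Lg (Suc n) A. \<exists>g\<in>GL0 (Suc n) A. mat_vec (Suc n) g x = last_unit n)"
proof (intro iffI ballI)
  fix x y assume x: "x \<in> Lg (Suc n) A" and y: "y \<in> Lg (Suc n) A"
    and tr: "\<forall>x\<in>Lg (Suc n) A. \<exists>g\<in>GL0 (Suc n) A. mat_vec (Suc n) g x = last_unit n"
  obtain g h where g: "g \<in> GL0 (Suc n) A" "mat_vec (Suc n) g x = last_unit n"
    and h: "h \<in> GL0 (Suc n) A" "mat_vec (Suc n) h y = last_unit n"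
    using tr x y by blast
  have "mat_vec (Suc n) (minv (Suc n) h) (last_unit n) = y"
    using h y GL0_subset_GL by (intro mat_vec_minv[of h _ A]) (auto simp: Lg_def PiE_extensional)
  then show "\<exists>g\<in>GL0 (Suc n) A. mat_vec (Suc n) g x = y"
    using g h(1) by (intro bexI[of _ "mat_mult (Suc n) (minv (Suc n) h) g"])
      (auto simp: mat_vec_mult intro: GL0_mult GL0_minv)
qed (use last_unit_Lg in blast)


section \<open>Pullbacks\<close>

lemma cstar_sum_simps [simp]:
  fixes x y :: "('b::unital_cstar_algebra, 'c::unital_cstar_algebra) cstar_sum"
  shows "cfst (x + y) = cfst x + cfst y" "csnd (x + y) = csnd x + csnd y"
    "cfst (x * y) = cfst x * cfst y" "csnd (x * y) = csnd x * csnd y"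
    "cfst (r *\<^sub>R x) = r *\<^sub>R cfst x" "csnd (r *\<^sub>R x) = r *\<^sub>R csnd x"
    "cfst (0 :: ('b, 'c) cstar_sum) = 0" "csnd (0 :: ('b, 'c) cstar_sum) = 0"
    "cfst (1 :: ('b, 'c) cstar_sum) = 1" "csnd (1 :: ('b, 'c) cstar_sum) = 1"
  by (simp_all add: cstar_sum_ops)

lemma bounded_linear_cfst: "bounded_linear (cfst :: ('b::unital_cstar_algebra, 'c::unital_cstar_algebra) cstar_sum \<Rightarrow> 'b)"
  by (rule bounded_linear_intro[where K=1]) (simp_all add: norm_cstar_sum_def)

lemma bounded_linear_csnd: "bounded_linear (csnd :: ('b::unital_cstar_algebra, 'c::unital_cstar_algebra) cstar_sum \<Rightarrow> 'c)"
  by (rule bounded_linear_intro[where K=1]) (simp_all add: norm_cstar_sum_def)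

lemma bounded_linear_CSum_left:
  "bounded_linear (\<lambda>b. CSum b 0 :: ('b::unital_cstar_algebra, 'c::unital_cstar_algebra) cstar_sum)"
  by (rule bounded_linear_intro[where K=1]) (simp_all add: norm_cstar_sum_def cstar_sum_vector_ops)

lemma bounded_linear_CSum_right:
  "bounded_linear (\<lambda>c. CSum 0 c :: ('b::unital_cstar_algebra, 'c::unital_cstar_algebra) cstar_sum)"
  by (rule bounded_linear_intro[where K=1]) (simp_all add: norm_cstar_sum_def cstar_sum_vector_ops)

lemma continuous_on_CSum:
  fixes f :: "'t::topological_space \<Rightarrow> 'b::unital_cstar_algebra"
    and g :: "'t \<Rightarrow> 'c::unital_cstar_algebra"
  assumes "continuous_on S f" "continuous_on S g"
  shows "continuous_on S (\<lambda>t. CSum (f t) (g t))"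
proof -
  have "CSum (f t) (g t) = CSum (f t) 0 + CSum 0 (g t)" for t
    by (simp add: cstar_sum_vector_ops)
  moreover have "continuous_on S (\<lambda>t. CSum (f t) 0 + CSum 0 (g t))"
    using assms bounded_linear.continuous_on[OF bounded_linear_CSum_left]
      bounded_linear.continuous_on[OF bounded_linear_CSum_right]
    by (intro continuous_intros) auto
  ultimately show ?thesis by simp
qed

text \<open>Closedness holds because the pullback is an equalizer of continuous maps, by the
  automatic continuity of \<delta> and \<gamma>.\<close>

lemma closed_subalgebra_pullback:
  fixes \<delta> :: "'b::unital_cstar_algebra \<Rightarrow> 'd::unital_cstar_algebra"
    and \<gamma> :: "'c::unital_cstar_algebra \<Rightarrow> 'd"
  assumes \<delta>: "unital_star_hom \<delta>" and \<gamma>: "unital_star_hom \<gamma>"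
  shows "closed_subalgebra (pullback \<delta> \<gamma>)"
proof
  have "continuous_on UNIV (\<lambda>x :: ('b, 'c) cstar_sum. \<delta> (cfst x))"
    by (rule bounded_linear.continuous_on[OF bounded_linear_star_hom[OF \<delta>]
          linear_continuous_on[OF bounded_linear_cfst]])
  moreover have "continuous_on UNIV (\<lambda>x :: ('b, 'c) cstar_sum. \<gamma> (csnd x))"
    by (rule bounded_linear.continuous_on[OF bounded_linear_star_hom[OF \<gamma>]
          linear_continuous_on[OF bounded_linear_csnd]])
  ultimately show "closed (pullback \<delta> \<gamma>)"
    unfolding pullback_def by (rule closed_Collect_eq)
qed (simp_all add: pullback_def star_homD[OF \<delta>] star_homD[OF \<gamma>])

lemma subalgebra_hom_cfst:
  assumes "unital_star_hom \<delta>" "unital_star_hom \<gamma>"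
  shows "subalgebra_hom (pullback \<delta> \<gamma>) UNIV cfst"
proof -
  interpret closed_subalgebra "pullback \<delta> \<gamma>"
    by (rule closed_subalgebra_pullback[OF assms])
  show ?thesis
    by unfold_locales (auto intro: linear_continuous_on bounded_linear_cfst)
qed

lemma subalgebra_hom_csnd:
  assumes "unital_star_hom \<delta>" "unital_star_hom \<gamma>"
  shows "subalgebra_hom (pullback \<delta> \<gamma>) UNIV csnd"
proof -
  interpret closed_subalgebra "pullback \<delta> \<gamma>"
    by (rule closed_subalgebra_pullback[OF assms])
  show ?thesis
    by unfold_locales (auto intro: linear_continuous_on bounded_linear_csnd)
qed

text \<open>Serves to reduce the case of surjective \<delta> to that of surjective \<gamma>.\<close>

lemma subalgebra_hom_swap:
  assumes "unital_star_hom \<delta>" "unital_star_hom \<gamma>"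
  shows "subalgebra_hom (pullback \<gamma> \<delta>) (pullback \<delta> \<gamma>) (\<lambda>x. CSum (csnd x) (cfst x))"
proof -
  interpret P: closed_subalgebra "pullback \<delta> \<gamma>"
    by (rule closed_subalgebra_pullback[OF assms])
  interpret P': closed_subalgebra "pullback \<gamma> \<delta>"
    by (rule closed_subalgebra_pullback[OF assms(2,1)])
  show ?thesis
  proof
    show "continuous_on (pullback \<gamma> \<delta>) (\<lambda>x. CSum (csnd x) (cfst x))"
      by (intro continuous_on_CSum linear_continuous_on bounded_linear_cfst bounded_linear_csnd)
  qed (auto simp: pullback_def cstar_sum_ops)
qed

section \<open>Matrices over the pullback as compatible pairs\<close>

definition mat_pair :: "nat \<Rightarrow> (nat \<times> nat \<Rightarrow> 'b) \<Rightarrow> (nat \<times> nat \<Rightarrow> 'c) \<Rightarrow> nat \<times> nat \<Rightarrow> ('b, 'c) cstar_sum" where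
  "mat_pair m b c = (\<lambda>q\<in>idx m. CSum (b q) (c q))"

lemma mmap_mat_pair:
  "b \<in> extensional (idx m) \<Longrightarrow> mmap m cfst (mat_pair m b c) = b"
  "c \<in> extensional (idx m) \<Longrightarrow> mmap m csnd (mat_pair m b c) = c"
  by (auto simp: mmap_def mat_pair_def extensional_def fun_eq_iff)

context
  fixes \<delta> :: "'b::unital_cstar_algebra \<Rightarrow> 'd::unital_cstar_algebra"
    and \<gamma> :: "'c::unital_cstar_algebra \<Rightarrow> 'd"
  assumes \<delta>: "unital_star_hom \<delta>" and \<gamma>: "unital_star_hom \<gamma>"
begin

interpretation \<delta>: subalgebra_hom UNIV UNIV \<delta> by (rule star_hom_subalgebra_hom[OF \<delta>])
interpretation \<gamma>: subalgebra_hom UNIV UNIV \<gamma> by (rule star_hom_subalgebra_hom[OF \<gamma>])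
interpretation P: closed_subalgebra "pullback \<delta> \<gamma>" by (rule closed_subalgebra_pullback[OF \<delta> \<gamma>])
interpretation fst: subalgebra_hom "pullback \<delta> \<gamma>" UNIV cfst by (rule subalgebra_hom_cfst[OF \<delta> \<gamma>])
interpretation snd: subalgebra_hom "pullback \<delta> \<gamma>" UNIV csnd by (rule subalgebra_hom_csnd[OF \<delta> \<gamma>])

lemma mat_pair_eqI:
  assumes "a \<in> extensional (idx m)" "a' \<in> extensional (idx m)"
    and "mmap m cfst a = mmap m cfst a'" "mmap m csnd a = mmap m csnd a'"
  shows "a = a'"
proof (rule mat_eqI[OF assms(1,2)])
  fix i j assume "i < m" "j < m"
  then show "a (i, j) = a' (i, j)"
    using fun_cong[OF assms(3), of "(i, j)"] fun_cong[OF assms(4), of "(i, j)"]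
    by (simp add: mmap_apply cstar_sum_eq_iff)
qed

text \<open>The pair of inverses is again compatible, since \<delta> and \<gamma> commute with
  inversion, so the inverse has its entries in the pullback.\<close>

lemma mat_pair_GL:
  assumes b: "b \<in> GL m UNIV" and c: "c \<in> GL m UNIV" and eq: "mmap m \<delta> b = mmap m \<gamma> c"
  shows "mat_pair m b c \<in> GL m (pullback \<delta> \<gamma>)"
proof -
  have PiE: "mat_pair m u v \<in> idx m \<rightarrow>\<^sub>E pullback \<delta> \<gamma>" if "mmap m \<delta> u = mmap m \<gamma> v" for u v
  proof (rule PiE_I)
    fix q assume "q \<in> idx m"
    then show "mat_pair m u v q \<in> pullback \<delta> \<gamma>"
      using fun_cong[OF that, of q] by (simp add: mmap_apply mat_pair_def pullback_def)
  qed (auto simp: mat_pair_def)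
  have eq': "mmap m \<delta> (minv m b) = mmap m \<gamma> (minv m c)"
    using \<delta>.mmap_GL(2)[OF b] \<gamma>.mmap_GL(2)[OF c] eq by simp
  note ext = GL_extensional[OF b] GL_extensional[OF c]
    GL_extensional[OF minv(3)[OF b]] GL_extensional[OF minv(3)[OF c]]
  have "mat_mult m (mat_pair m b c) (mat_pair m (minv m b) (minv m c)) = mat_one m"
    "mat_mult m (mat_pair m (minv m b) (minv m c)) (mat_pair m b c) = mat_one m"
    using PiE[OF eq] PiE[OF eq'] ext minv[OF b] minv[OF c]
    by (auto intro!: mat_pair_eqI[of _ m] simp: fst.mmap_mult snd.mmap_mult fst.mmap_one snd.mmap_one mmap_mat_pair)
  then show ?thesis
    using PiE[OF eq] PiE[OF eq'] unfolding GL_iff by blast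
qed

text \<open>Compatibility is asked at every \<open>t\<close>, not only at the end; the correction of
  the path over \<open>C\<close> in the next lemma is designed to achieve this.\<close>

lemma mat_pair_GL0:
  assumes b: "mat_path m UNIV b" "b 0 = mat_one m" and c: "mat_path m UNIV c" "c 0 = mat_one m"
    and eq: "\<And>t. t \<in> {0..1} \<Longrightarrow> mmap m \<delta> (b t) = mmap m \<gamma> (c t)"
  shows "mat_pair m (b 1) (c 1) \<in> GL0 m (pullback \<delta> \<gamma>)"
  unfolding P.GL0_iff_path
proof (intro exI conjI)
  have GL: "mat_pair m (b t) (c t) \<in> GL m (pullback \<delta> \<gamma>)" if t: "t \<in> {0..1}" for t
    using b(1) c(1) t by (intro mat_pair_GL eq) (auto simp: mat_path_def)
  have "continuous_on {0..1} (\<lambda>t. mat_pair m (b t) (c t) q)" if q: "q \<in> idx m" for q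
  proof -
    have "continuous_on {0..1} (\<lambda>t. b t q)" "continuous_on {0..1} (\<lambda>t. c t q)"
      using b(1) c(1) q unfolding mat_path_def mat_continuous_on_def by blast+
    then have "continuous_on {0..1} (\<lambda>t. CSum (b t q) (c t q))" by (rule continuous_on_CSum)
    then show ?thesis using q by (simp add: mat_pair_def)
  qed
  with GL show "mat_path m (pullback \<delta> \<gamma>) (\<lambda>t. mat_pair m (b t) (c t))"
    unfolding mat_path_def mat_continuous_on_def by blast
  show "mat_pair m (b 0) (c 0) = mat_one m"
    unfolding b(2) c(2)
    by (rule mat_eqI[of _ m]) (auto simp: mat_pair_def mat_one_def cstar_sum_ops)
qed simp

lemma pullback_transitive:
  assumes surj: "surj \<gamma>"
    and trB: "\<forall>x\<in>Lg (Suc n) (UNIV :: 'b set). \<exists>g\<in>GL0 (Suc n) UNIV. mat_vec (Suc n) g x = last_unit n"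
    and trC: "\<forall>x\<in>Lg (Suc n) (UNIV :: 'c set). \<exists>g\<in>GL0 (Suc n) UNIV. mat_vec (Suc n) g x = last_unit n"
    and inj: "inj_on (GL_stabilization 0 (Suc n) (UNIV :: 'd set)) (GL_homotopy_group 0 n UNIV)"
    and surj1: "GL_stabilization 1 (Suc n) (UNIV :: 'd set) ` GL_homotopy_group 1 n UNIV =
      GL_homotopy_group 1 (Suc n) UNIV"
    and x: "x \<in> Lg (Suc n) (pullback \<delta> \<gamma>)"
  shows "\<exists>g\<in>GL0 (Suc n) (pullback \<delta> \<gamma>). mat_vec (Suc n) g x = last_unit n"
proof -
  let ?m = "Suc n"
  note GL0_GL = subsetD[OF UNIV_subalgebra.GL0_subset_GL]
  have xP: "x \<in> {..<?m} \<rightarrow>\<^sub>E pullback \<delta> \<gamma>" using x by (simp add: Lg_def)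
  define xB xC where "xB = vmap ?m cfst x" and "xC = vmap ?m csnd x"
  obtain b where b: "b \<in> GL0 ?m UNIV" "mat_vec ?m b xB = last_unit n"
    using trB fst.vmap_Lg[OF x] unfolding xB_def by blast
  obtain c where c: "c \<in> GL0 ?m UNIV" "mat_vec ?m c xC = last_unit n"
    using trC snd.vmap_Lg[OF x] unfolding xC_def by blast
  define xD where "xD = vmap ?m \<delta> xB"
  have xD: "xD = vmap ?m \<gamma> xC"
    using xP by (auto simp: xD_def xB_def xC_def vmap_def pullback_def PiE_iff fun_eq_iff)
  have \<delta>b: "mat_vec ?m (mmap ?m \<delta> b) xD = last_unit n"
    using \<delta>.mat_vec_mmap[OF GL_PiE[OF GL0_GL[OF b(1)]], of xB] b(2)
    by (simp add: xD_def xB_def vmap_PiE_UNIV \<delta>.vmap_last_unit)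
  have \<gamma>c: "mat_vec ?m (mmap ?m \<gamma> c) xD = last_unit n"
    using \<gamma>.mat_vec_mmap[OF GL_PiE[OF GL0_GL[OF c(1)]], of xC] c(2)
    by (simp add: xD xC_def vmap_PiE_UNIV \<gamma>.vmap_last_unit)
  define d where "d = mat_mult ?m (mmap ?m \<delta> b) (minv ?m (mmap ?m \<gamma> c))"
  have \<gamma>c0: "mmap ?m \<gamma> c \<in> GL0 ?m UNIV" by (rule \<gamma>.mmap_GL0[OF c(1)])
  have d0: "d \<in> GL0 ?m UNIV"
    unfolding d_def by (intro UNIV_subalgebra.GL0_mult UNIV_subalgebra.GL0_minv \<gamma>c0 \<delta>.mmap_GL0 b(1))
  have "mat_vec ?m (minv ?m (mmap ?m \<gamma> c)) (last_unit n) = xD"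
    by (rule mat_vec_minv[OF GL0_GL[OF \<gamma>c0] _ \<gamma>c]) (simp add: xD_def)
  then have d_fix: "mat_vec ?m d (last_unit n) = last_unit n"
    unfolding d_def mat_vec_mult using \<delta>b by simp
  have d\<gamma>c: "mat_mult ?m d (mmap ?m \<gamma> c) = mmap ?m \<delta> b"
    unfolding d_def by (rule minv_mult_cancel_right(2)[OF GL0_GL[OF \<gamma>c0]]) simp
  define d' where "d' = restrict d (idx n)"
  define r where "r j = d (n, j)" for j
  have dec: "mat_mult ?m (mat_embed n d') (lower_row n r) = d"
    using stabilizer_decomposition[OF GL_extensional[OF GL0_GL[OF d0]] d_fix]
    by (simp add: d'_def r_def[abs_def])
  \<comment> \<open>Both \<open>d\<close> and the unipotent factor lie in the identity component,
    hence so does the embedded corner, as the use of injectivity requires.\<close>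
  have "mat_embed n d' = mat_mult ?m d (minv ?m (lower_row n r))"
    using minv_mult_cancel_right(1)[OF GL0_GL[OF lower_row_GL0], of "mat_embed n d'" n r] dec by simp
  then have emb0: "mat_embed n d' \<in> GL0 ?m UNIV"
    using UNIV_subalgebra.GL0_mult[OF d0 UNIV_subalgebra.GL0_minv[OF lower_row_GL0]] by simp
  have "d' \<in> GL n UNIV"
    by (rule mat_embed_GL_D[OF _ GL0_GL[OF emb0]]) (simp add: d'_def)
  then have "d' \<in> GL0 n UNIV"
    by (rule UNIV_subalgebra.stabilization_inj_0D[OF inj _ emb0])
  then obtain k where k: "k \<in> GL0 n UNIV" "mmap n \<gamma> k = d'"
    by (rule GL0_lift[OF \<gamma> surj])
  \<comment> \<open>Only a single row is lifted here, so entrywise choice suffices, without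
    continuity.\<close>
  define w where "w j = (SOME c. \<gamma> c = r j)" for j
  have w: "\<gamma> (w j) = r j" for j
    unfolding w_def by (rule someI_ex) (metis surj surjD)
  \<comment> \<open>Left multiplication by a lift of \<open>d\<close> turns
    \<gamma>(\<open>c\<close>) into \<delta>(\<open>b\<close>), and both factors of that lift fix
    the last unit vector.\<close>
  define c1 where "c1 = mat_mult ?m (mat_mult ?m (mat_embed n k) (lower_row n w)) c"
  have c1_0: "c1 \<in> GL0 ?m UNIV"
    unfolding c1_def
    by (intro UNIV_subalgebra.GL0_mult UNIV_subalgebra.mat_embed_GL0 k(1) lower_row_GL0 c(1))
  have c1x: "mat_vec ?m c1 xC = last_unit n"
    by (simp add: c1_def mat_vec_mult c(2) lower_row_last_unit mat_embed_last_unit)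
  have PiE0: "g \<in> idx m \<rightarrow>\<^sub>E UNIV" if "g \<in> GL0 m UNIV" for g :: "nat \<times> nat \<Rightarrow> 'c" and m
    by (rule GL_PiE[OF GL0_GL[OF that]])
  have \<gamma>c1: "mmap ?m \<gamma> c1 = mmap ?m \<delta> b"
  proof -
    have "mmap ?m \<gamma> c1 = mat_mult ?m (mat_mult ?m (mat_embed n d') (lower_row n r)) (mmap ?m \<gamma> c)"
      unfolding c1_def
      by (simp add: \<gamma>.mmap_mult PiE0 UNIV_subalgebra.GL0_mult UNIV_subalgebra.mat_embed_GL0
          k lower_row_GL0 c(1) \<gamma>.mmap_embed \<gamma>.mmap_lower_row w)
    then show ?thesis using dec d\<gamma>c by simp
  qed
  obtain bt where bt: "mat_path ?m UNIV bt" "bt 0 = mat_one ?m" "bt 1 = b"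
    using b(1) by (auto simp: UNIV_subalgebra.GL0_iff_path)
  obtain ct where ct: "mat_path ?m UNIV ct" "ct 0 = mat_one ?m" "ct 1 = c1"
    using c1_0 by (auto simp: UNIV_subalgebra.GL0_iff_path)
  \<comment> \<open>The path \<open>ct\<close> runs to the corrected \<open>c1\<close>, so
    \<delta>(\<open>bt\<close>) and \<gamma>(\<open>ct\<close>) agree at both ends and their
    quotient closes up.\<close>
  define loop where "loop t = mat_mult ?m (mmap ?m \<delta> (bt t)) (minv ?m (mmap ?m \<gamma> (ct t)))" for t
  have loop: "mat_path ?m UNIV loop" "loop 0 = mat_one ?m" "loop 1 = mat_one ?m"
  proof -
    show "mat_path ?m UNIV loop"
      unfolding loop_def
      by (intro UNIV_subalgebra.mat_path_mult mat_path_minv \<delta>.mat_path_mmap \<gamma>.mat_path_mmap bt ct)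
    show "loop 0 = mat_one ?m"
      by (simp add: loop_def bt ct \<delta>.mmap_one \<gamma>.mmap_one minv_one mat_mult_one_left)
    show "loop 1 = mat_one ?m"
      using minv(1)[OF \<gamma>.mmap_GL(1)[OF GL0_GL[OF c1_0]]] \<gamma>c1 by (simp add: loop_def bt ct)
  qed
  obtain l and H :: "real \<Rightarrow> real \<Rightarrow> nat \<times> nat \<Rightarrow> 'd" where l: "mat_path n UNIV l" "l 0 = mat_one n" "l 1 = mat_one n"
    and Hcont: "mat_continuous_on ({0..1} \<times> {0..1}) ?m (\<lambda>(s, t). H s t)"
    and HGL: "\<forall>s\<in>{0..1}. \<forall>t\<in>{0..1}. H s t \<in> GL ?m UNIV"
    and H01: "\<forall>t\<in>{0..1}. H 0 t = mat_embed n (l t) \<and> H 1 t = loop t"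
    and Hends: "\<forall>s\<in>{0..1}. H s 0 = mat_one ?m \<and> H s 1 = mat_one ?m"
    using UNIV_subalgebra.stabilization_surj_1D[OF surj1 loop] .
  \<comment> \<open>\<open>l\<close> is closed but \<open>kt\<close> need not be: its end is only
    known to lie over the identity.\<close>
  obtain kt where kt: "mat_path n UNIV kt" "kt 0 = mat_one n"
    and \<gamma>kt: "\<And>t. t \<in> {0..1} \<Longrightarrow> mmap n \<gamma> (kt t) = l t"
    using mat_path_lift[OF \<gamma> surj l(1,2)] by blast
  have lift0: "mmap ?m \<gamma> (mat_embed n (kt t)) = H 0 t" if "t \<in> {0..1}" for t
    using H01 that by (simp add: \<gamma>.mmap_embed \<gamma>kt)
  obtain q where q: "mat_path ?m UNIV q" "\<And>t. t \<in> {0..1} \<Longrightarrow> mmap ?m \<gamma> (q t) = H 1 t"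
    "\<And>t. t \<in> {0,1} \<Longrightarrow> (\<And>s. s \<in> {0..1} \<Longrightarrow> H s t = H 0 t) \<Longrightarrow> q t = mat_embed n (kt t)"
    using GL_homotopy_lift[OF \<gamma> surj Hcont _ UNIV_subalgebra.mat_path_embed[OF kt(1)] lift0] HGL
    by metis
  \<comment> \<open>The homotopy \<open>H\<close> is stationary at \<open>t = 0\<close> and
    \<open>t = 1\<close>, so \<open>q\<close> has the ends of the embedded
    \<open>kt\<close>.\<close>
  have q_ends: "q 0 = mat_one ?m" "q 1 = mat_embed n (kt 1)"
    using q(3)[of 0] q(3)[of 1] Hends kt(2) by (auto simp: mat_embed_one)
  \<comment> \<open>\<open>loop\<close> times \<gamma>(\<open>ct\<close>) is
    \<delta>(\<open>bt\<close>), so multiplying \<open>ct\<close> by a lift of \<open>loop\<close>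
    makes the pair compatible at every \<open>t\<close>.\<close>
  define et where "et t = mat_mult ?m (q t) (ct t)" for t
  have et_path: "mat_path ?m UNIV et"
    unfolding et_def by (rule UNIV_subalgebra.mat_path_mult[OF q(1) ct(1)])
  have \<gamma>et: "mmap ?m \<delta> (bt t) = mmap ?m \<gamma> (et t)" if t: "t \<in> {0..1}" for t
  proof -
    have GL: "q t \<in> GL ?m UNIV" "ct t \<in> GL ?m UNIV" using q(1) ct(1) t by (auto simp: mat_path_def)
    have "mmap ?m \<gamma> (et t) = mat_mult ?m (loop t) (mmap ?m \<gamma> (ct t))"
      unfolding et_def using \<gamma>.mmap_mult[OF GL_PiE[OF GL(1)] GL_PiE[OF GL(2)]] q(2)[OF t] H01 t by simp
    also have "\<dots> = mmap ?m \<delta> (bt t)"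
      unfolding loop_def by (rule minv_mult_cancel_right(2)[OF \<gamma>.mmap_GL(1)[OF GL(2)]]) simp
    finally show ?thesis ..
  qed
  define g where "g = mat_pair ?m (bt 1) (et 1)"
  have g0: "g \<in> GL0 ?m (pullback \<delta> \<gamma>)"
    unfolding g_def
    by (rule mat_pair_GL0[OF bt(1,2) et_path _ \<gamma>et])
      (simp_all add: et_def q_ends ct mat_mult_one_left)
  have gP: "g \<in> idx ?m \<rightarrow>\<^sub>E pullback \<delta> \<gamma>"
    by (rule GL_PiE[OF subsetD[OF P.GL0_subset_GL g0]])
  have "b \<in> extensional (idx ?m)" by (rule GL_extensional[OF GL0_GL[OF b(1)]])
  then have fst: "vmap ?m cfst (mat_vec ?m g x) = last_unit n"
    using fst.mat_vec_mmap[OF gP xP] b(2) by (simp add: g_def mmap_mat_pair bt(3) xB_def)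
  \<comment> \<open>The end of \<open>et\<close> differs from \<open>c1\<close> by
    diag(\<open>kt 1\<close>, 1), which leaves the last unit vector in place.\<close>
  have "mat_vec ?m (et 1) xC = last_unit n"
    by (simp add: et_def q_ends ct mat_vec_mult c1x mat_embed_last_unit)
  then have snd: "vmap ?m csnd (mat_vec ?m g x) = last_unit n"
    using snd.mat_vec_mmap[OF gP xP] by (simp add: g_def mmap_mat_pair et_def xC_def)
  have "mat_vec ?m g x = last_unit n"
  proof (rule vec_eqI[of _ ?m])
    fix i assume i: "i < ?m"
    then show "mat_vec ?m g x i = last_unit n i"
      using fun_cong[OF fst, of i] fun_cong[OF snd, of i]
      by (auto simp: cstar_sum_eq_iff vmap_def last_unit_def split: if_splits)
  qed auto
  with g0 show ?thesis by blast
qed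

end

text \<open>Exchanging the factors twice is the identity: move the exchanged vector, then exchange
  the entries of the matrix that moves it.\<close>

lemma pullback_transitive_swap:
  fixes \<delta> :: "'b::unital_cstar_algebra \<Rightarrow> 'd::unital_cstar_algebra"
    and \<gamma> :: "'c::unital_cstar_algebra \<Rightarrow> 'd"
  assumes hom: "unital_star_hom \<delta>" "unital_star_hom \<gamma>"
    and tr: "\<forall>x\<in>Lg (Suc n) (pullback \<gamma> \<delta>). \<exists>g\<in>GL0 (Suc n) (pullback \<gamma> \<delta>). mat_vec (Suc n) g x = last_unit n"
    and x: "x \<in> Lg (Suc n) (pullback \<delta> \<gamma>)"
  shows "\<exists>g\<in>GL0 (Suc n) (pullback \<delta> \<gamma>). mat_vec (Suc n) g x = last_unit n"
proof -
  let ?s = "\<lambda>x :: ('b, 'c) cstar_sum. CSum (csnd x) (cfst x)"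
  let ?s' = "\<lambda>x :: ('c, 'b) cstar_sum. CSum (csnd x) (cfst x)"
  interpret s: subalgebra_hom "pullback \<delta> \<gamma>" "pullback \<gamma> \<delta>" ?s
    by (rule subalgebra_hom_swap[OF hom(2,1)])
  interpret s': subalgebra_hom "pullback \<gamma> \<delta>" "pullback \<delta> \<gamma>" ?s'
    by (rule subalgebra_hom_swap[OF hom])
  have sx: "vmap (Suc n) ?s x \<in> Lg (Suc n) (pullback \<gamma> \<delta>)" by (rule s.vmap_Lg[OF x])
  then obtain g where g: "g \<in> GL0 (Suc n) (pullback \<gamma> \<delta>)"
    "mat_vec (Suc n) g (vmap (Suc n) ?s x) = last_unit n"
    using tr by blast
  have "vmap (Suc n) ?s' (vmap (Suc n) ?s x) = x"
    using x by (intro vec_eqI[of _ "Suc n"]) (auto simp: vmap_def Lg_def PiE_extensional)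
  then have "mat_vec (Suc n) (mmap (Suc n) ?s' g) x = last_unit n"
    using s'.mat_vec_mmap[of g "Suc n" "vmap (Suc n) ?s x"] g sx
      GL_PiE[OF subsetD[OF s.B.GL0_subset_GL g(1)]]
    by (simp add: s'.vmap_last_unit Lg_def)
  then show ?thesis using s'.mmap_GL0[OF g(1)] by blast
qed

theorem theorem2p14:
  fixes \<delta> :: "'b::unital_cstar_algebra \<Rightarrow> 'd::unital_cstar_algebra"
    and \<gamma> :: "'c::unital_cstar_algebra \<Rightarrow> 'd"
  assumes "unital_star_hom \<delta>"
    and "unital_star_hom \<gamma>"
    and "surj \<gamma> \<or> surj \<delta>"
  shows "csr (pullback \<delta> \<gamma>)
    \<le> Max {csr (UNIV :: 'b set), csr (UNIV :: 'c set),
           inj_rank 0 (UNIV :: 'd set), surj_rank 1 (UNIV :: 'd set)}"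
proof (cases "Max {csr (UNIV :: 'b set), csr (UNIV :: 'c set),
           inj_rank 0 (UNIV :: 'd set), surj_rank 1 (UNIV :: 'd set)}")
  case (enat N)
  then have le: "csr (UNIV :: 'b set) \<le> enat N" "csr (UNIV :: 'c set) \<le> enat N"
    "inj_rank 0 (UNIV :: 'd set) \<le> enat N" "surj_rank 1 (UNIV :: 'd set) \<le> enat N"
    by (metis Max_ge finite.emptyI finite.insertI insertCI)+
  interpret P: closed_subalgebra "pullback \<delta> \<gamma>" by (rule closed_subalgebra_pullback[OF assms(1,2)])
  have "\<forall>x\<in>Lg m (pullback \<delta> \<gamma>). \<forall>y\<in>Lg m (pullback \<delta> \<gamma>). \<exists>g\<in>GL0 m (pullback \<delta> \<gamma>). mat_vec m g x = y"
    if "m \<ge> N" for m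
  proof -
    \<comment> \<open>A bound on \<open>csr\<close> includes positivity, so \<open>m\<close> has the
      form \<open>Suc n\<close>, and the source size \<open>m - 1\<close> in the two homotopy ranks
      becomes \<open>n\<close>.\<close>
    have "N \<ge> 1" using le(1) by (simp add: csr_def least_stable_le_iff)
    then obtain n where m: "m = Suc n" using \<open>m \<ge> N\<close> by (cases m) auto
    have trB: "\<forall>x\<in>Lg (Suc n) (UNIV :: 'b set). \<exists>g\<in>GL0 (Suc n) UNIV. mat_vec (Suc n) g x = last_unit n"
      using le(1) \<open>m \<ge> N\<close>
      unfolding csr_def least_stable_le_iff m UNIV_subalgebra.transitive_iff[symmetric] by blast
    have trC: "\<forall>x\<in>Lg (Suc n) (UNIV :: 'c set). \<exists>g\<in>GL0 (Suc n) UNIV. mat_vec (Suc n) g x = last_unit n"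
      using le(2) \<open>m \<ge> N\<close>
      unfolding csr_def least_stable_le_iff m UNIV_subalgebra.transitive_iff[symmetric] by blast
    have inj: "inj_on (GL_stabilization 0 (Suc n) (UNIV :: 'd set)) (GL_homotopy_group 0 n UNIV)"
      using le(3) \<open>m \<ge> N\<close> unfolding inj_rank_def least_stable_le_iff m by (metis diff_Suc_1)
    have surj1: "GL_stabilization 1 (Suc n) (UNIV :: 'd set) ` GL_homotopy_group 1 n UNIV =
        GL_homotopy_group 1 (Suc n) UNIV"
      using le(4) \<open>m \<ge> N\<close> unfolding surj_rank_def least_stable_le_iff m by (metis diff_Suc_1)
    have "\<forall>x\<in>Lg (Suc n) (pullback \<delta> \<gamma>). \<exists>g\<in>GL0 (Suc n) (pullback \<delta> \<gamma>). mat_vec (Suc n) g x = last_unit n"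
      using assms(3)
    proof
      assume "surj \<gamma>"
      then show ?thesis
        using pullback_transitive[OF assms(1,2) _ trB trC inj surj1] by blast
    next
      assume "surj \<delta>"
      then show ?thesis
        using pullback_transitive[OF assms(2,1) _ trC trB inj surj1]
        by (intro ballI pullback_transitive_swap[OF assms(1,2)]) blast+
    qed
    then show ?thesis unfolding m P.transitive_iff .
  qed
  moreover have "N \<ge> 1" using le(1) by (simp add: csr_def least_stable_le_iff)
  ultimately have "csr (pullback \<delta> \<gamma>) \<le> enat N"
    unfolding csr_def least_stable_le_iff by blast
  then show ?thesis using enat by simp
qed simp

end
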